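(* Let $r>0$ and fix $e\in\{1,\dots,n\}$. The function $$u(\mathsf x)=\mathbb P\big(T^\star=T_{(e,r)}\mid \mathcal Z(0)=\mathsf x\big)$$ satisfies the Dirichlet problem on the ball $B_r(0)$ with boundary values $1$ at $(e,r)$ and $0$ at $(j,r)$, $j\ne e$; that is: $u$ belongs to the domain $D(A_{\mathcal X})$, $A_{\mathcal X}u(\mathsf x)=0$ for $\mathsf x\in B_r(0)$, $u_e(r)=1$, and $u_j(r)=0$ for all $j\neq e$.
   Context: Star graph: take $n$ copies $\mathsf e_j=[0,\infty)$, $j=1,\dots,n$, denote points by $(j,x)$ ($j$ the ray, $x\ge0$ the distance from the origin), and identify all the points $(j,0)$ to a single vertex $0$; the quotient is $\mathsf E$, with distance $d((j,x),(k,y))=|x-y|$ if $j=k$ and $x+y$ if $j\ne k$. For $f$ on $\mathsf E$ write $f_j(x)=f(j,x)$ and $f_j'(0)=\lim_{r\downarrow0}\frac{\partial}{\partial r}f(j,r)$. $C_0(\mathsf E)$ is the space of continuous functions vanishing at infinity, and $C_0^2(\mathsf E)$ the space of $f\in C_0(\mathsf E)$ twice continuously differentiable on each open ray whose second derivative extends to a function in $C_0(\mathsf E)$; $f''(0)=\lim_{x\to0}f_j''(x)$ (finite, independent of $j$). Weights $p_1,\dots,p_n\in[0,1]$ with $\sum_k p_k=1$ and constants $b,c>0$ with $b+c=1$ are fixed. $\mathcal Z$ is the standard Brownian motion on $\mathsf E$: the continuous strong Markov process with generator $\frac12 f_j''$ and domain $\{f\in C_0^2(\mathsf E):\sum_k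 p_kf_k'(0)=0\}$; its radial component is a reflected Brownian motion on $[0,\infty)$. The operator $A_{\mathcal X}$ associated with the sticky Brownian motion is $A_{\mathcal X}f(\mathsf x)=f_j''(x)$ for $\mathsf x=(j,x)$, with $$D(A_{\mathcal X})=\Big\{f\in C_0^2(\mathsf E):\tfrac12 c f''(0)=b\sum_{k=1}^n p_kf_k'(0)\Big\}.$$ For a function defined only on the closed ball of radius $r$, membership in $D(A_{\mathcal X})$ means: it is continuous, twice continuously differentiable on each open segment $\{(j,x):0<x<r\}$, its second derivative extends continuously to the vertex (with a common limit $f''(0)$ along all rays), and the vertex condition $\frac12 c f''(0)=b\sum_k p_kf_k'(0)$ holds. $B_r=B_r(0)=\{(j,x)\in\mathsf E: x<r\}$; its boundary consists of the $n$ points $(j,r)$. $T_{(e,r)}=\inf\{t>0:\mathcal Z(t)=(e,r)\}$ and $T^\star=\inf\{t>0:|\mathcal Z(t)|=r\}=\min_{e}T_{(e,r)}$, where $|\cdot|$ is the radial component (distance from $0$). *)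

theory Defs
  imports "HOL-Probability.Probability"
begin

section \<open>The star graph\<close>

text \<open>The rays are indexed by a finite (hence nonempty) type \<open>'n\<close>, so the number of rays is
  \<open>CARD('n)\<close>.  A point is represented by a pair of a ray and a distance \<open>\<ge> 0\<close>; all pairs with
  distance \<open>0\<close> are identified.\<close>

definition star_rel :: "'n \<times> real \<Rightarrow> 'n \<times> real \<Rightarrow> bool" where
  "star_rel p q \<longleftrightarrow> 0 \<le> snd p \<and> snd p = snd q \<and> (fst p = fst q \<or> snd p = 0)"

quotient_type 'n star = "'n \<times> real" / partial: star_rel
proof (rule part_equivpI)
  show "\<exists>x. star_rel x x"
    by (intro exI[of _ "(undefined, 0)"]) (simp add: star_rel_def)
  show "symp star_rel"
    by (auto simp: symp_def star_rel_def)
  show "transp star_rel"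
    by (auto simp: transp_def star_rel_def)
qed

text \<open>The argument of \<open>ray\<close> is clamped only to make it total; it is used for \<open>x \<ge> 0\<close>.\<close>

lift_definition ray :: "'n \<Rightarrow> real \<Rightarrow> 'n star" is "\<lambda>j x. (j, max 0 x)"
  by (simp add: star_rel_def)

lift_definition vertex :: "'n star" is "(undefined, 0)"
  by (simp add: star_rel_def)

instantiation star :: (type) metric_space
begin

lift_definition dist_star :: "'n star \<Rightarrow> 'n star \<Rightarrow> real" is
  "\<lambda>(j, x) (k, y). if j = k then \<bar>x - y\<bar> else x + y"
  by (auto simp: star_rel_def split: if_splits)

definition uniformity_star :: "('n star \<times> 'n star) filter" where
  "uniformity_star = (INF e\<in>{0 <..}. principal {(x, y). dist x y < e})"

definition open_star :: "'n star set \<Rightarrow> bool" where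
  "open_star U \<longleftrightarrow> (\<forall>x\<in>U. eventually (\<lambda>(x', y). x' = x \<longrightarrow> y \<in> U) uniformity)"

instance
proof
  fix x y z :: "'n star"
  show "dist x y = 0 \<longleftrightarrow> x = y"
    by transfer (auto simp: star_rel_def split: if_splits)
  show "dist x y \<le> dist x z + dist y z"
    by transfer (auto simp: star_rel_def split: if_splits)
qed (auto simp: uniformity_star_def open_star_def)

end

lemma ray_0: "ray j 0 = vertex"
  by transfer (simp add: star_rel_def)

lemma ray_cases: obtains j x where "0 \<le> x" "p = ray j x"
proof -
  have "\<exists>j x. 0 \<le> x \<and> p = ray j x"
    by transfer (metis max_absorb2 snd_conv star_rel_def surj_pair)
  with that show thesis by blast
qed

lemma dist_ray:
  "0 \<le> x \<Longrightarrow> 0 \<le> y \<Longrightarrow> dist (ray j x) (ray k y) = (if j = k then \<bar>x - y\<bar> else x + y)"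
  by transfer simp

lemma dist_vertex_ray: "0 \<le> x \<Longrightarrow> dist vertex (ray j x) = x"
  by transfer auto

section \<open>Functions on the star graph\<close>

definition d1 :: "('n star \<Rightarrow> real) \<Rightarrow> 'n \<Rightarrow> real \<Rightarrow> real" where
  "d1 f j = deriv (\<lambda>x. f (ray j x))"

definition d2 :: "('n star \<Rightarrow> real) \<Rightarrow> 'n \<Rightarrow> real \<Rightarrow> real" where
  "d2 f j = deriv (d1 f j)"

definition C2_on_rays :: "real set \<Rightarrow> ('n star \<Rightarrow> real) \<Rightarrow> bool" where
  "C2_on_rays I f \<longleftrightarrow> (\<forall>j. (\<lambda>x. f (ray j x)) differentiable_on I \<and>
     d1 f j differentiable_on I \<and> continuous_on I (d2 f j))"

definition d1_vertex :: "('n star \<Rightarrow> real) \<Rightarrow> 'n \<Rightarrow> real" where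
  "d1_vertex f j = Lim (at_right 0) (d1 f j)"

definition d2_vertex :: "('n star \<Rightarrow> real) \<Rightarrow> real" where
  "d2_vertex f = (THE l. \<forall>j. (d2 f j \<longlongrightarrow> l) (at_right 0))"

lift_definition glue :: "'a \<Rightarrow> ('n \<Rightarrow> real \<Rightarrow> 'a) \<Rightarrow> 'n star \<Rightarrow> 'a" is
  "\<lambda>a g (j, x). if x = 0 then a else g j x"
  by (auto simp: star_rel_def)

lemma glue_vertex: "glue a g vertex = a"
  by transfer simp

lemma glue_ray: "0 < x \<Longrightarrow> glue a g (ray j x) = g j x"
  by transfer simp

definition second_deriv :: "('n star \<Rightarrow> real) \<Rightarrow> 'n star \<Rightarrow> real" where
  "second_deriv f = glue (d2_vertex f) (d2 f)"

definition C0 :: "('a::topological_space \<Rightarrow> real) set" where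
  "C0 = {f. continuous_on UNIV f \<and> (\<forall>\<epsilon>>0. \<exists>K. compact K \<and> (\<forall>x. x \<notin> K \<longrightarrow> \<bar>f x\<bar> < \<epsilon>))}"

definition C02 :: "('n star \<Rightarrow> real) set" where
  "C02 = {f \<in> C0. C2_on_rays {0<..} f \<and> (\<exists>g\<in>C0. \<forall>j. \<forall>x>0. g (ray j x) = d2 f j x)}"

section \<open>Markov processes and generators\<close>

definition natural_filtration ::
    "'w measure \<Rightarrow> (real \<Rightarrow> 'w \<Rightarrow> 's::topological_space) \<Rightarrow> ennreal \<Rightarrow> 'w measure" where
  "natural_filtration \<Omega> Z t =
     sigma (space \<Omega>) {Z s -` B \<inter> space \<Omega> | s B. 0 \<le> s \<and> ennreal s \<le> t \<and> B \<in> sets borel}"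

definition semigroup ::
    "('s \<Rightarrow> 'w measure) \<Rightarrow> (real \<Rightarrow> 'w \<Rightarrow> 's) \<Rightarrow> real \<Rightarrow> ('s \<Rightarrow> real) \<Rightarrow> 's \<Rightarrow> real" where
  "semigroup P Z t f x = (\<integral>\<omega>. f (Z t \<omega>) \<partial>P x)"

text \<open>\<open>P x\<close> is the law under which the process starts in \<open>x\<close>.  Stopping times may take the value
  \<open>\<infinity>\<close>; \<open>Z (enn2real (T \<omega>))\<close> is only looked at where \<open>T \<omega> < \<infinity>\<close>.\<close>

locale continuous_strong_Markov_process =
  fixes \<Omega> :: "'w measure"
    and P :: "'s::metric_space \<Rightarrow> 'w measure"
    and Z :: "real \<Rightarrow> 'w \<Rightarrow> 's"
  assumes prob_space_P: "prob_space (P x)"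
    and sets_P: "sets (P x) = sets \<Omega>"
    and measurable_Z: "0 \<le> t \<Longrightarrow> Z t \<in> \<Omega> \<rightarrow>\<^sub>M borel"
    and continuous_paths: "\<omega> \<in> space \<Omega> \<Longrightarrow> continuous_on {0..} (\<lambda>t. Z t \<omega>)"
    and start: "AE \<omega> in P x. Z 0 \<omega> = x"
    and kernel: "0 \<le> t \<Longrightarrow> (\<lambda>x. distr (P x) borel (Z t)) \<in> borel \<rightarrow>\<^sub>M prob_algebra borel"
    and strong_Markov:
      "\<lbrakk>stopping_time (natural_filtration \<Omega> Z) T;
        A \<in> sets (filtration.pre_sigma (space \<Omega>) (natural_filtration \<Omega> Z) T);
        f \<in> borel_measurable borel; bounded (range f); 0 \<le> t\<rbrakk> \<Longrightarrow>
       (\<integral>\<omega>. indicator (A \<inter> {\<omega>. T \<omega> < \<infinity>}) \<omega> * f (Z (enn2real (T \<omega>) + t) \<omega>) \<partial>P x) =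
       (\<integral>\<omega>. indicator (A \<inter> {\<omega>. T \<omega> < \<infinity>}) \<omega> * semigroup P Z t f (Z (enn2real (T \<omega>)) \<omega>) \<partial>P x)"

text \<open>The process is Feller, and \<open>G\<close> on the domain \<open>D\<close> is exactly the generator of its semigroup on
  \<open>C0\<close> with the supremum norm.\<close>

definition has_generator ::
    "('s::metric_space \<Rightarrow> 'w measure) \<Rightarrow> (real \<Rightarrow> 'w \<Rightarrow> 's) \<Rightarrow>
     ('s \<Rightarrow> real) set \<Rightarrow> (('s \<Rightarrow> real) \<Rightarrow> 's \<Rightarrow> real) \<Rightarrow> bool" where
  "has_generator P Z D G \<longleftrightarrow>
     (\<forall>t\<ge>0. \<forall>f\<in>C0. semigroup P Z t f \<in> C0) \<and>
     (\<forall>f\<in>C0. \<forall>g\<in>C0.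
        uniform_limit UNIV (\<lambda>t x. (semigroup P Z t f x - f x) / t) g (at_right 0)
          \<longleftrightarrow> f \<in> D \<and> g = G f)"

definition star_BM ::
    "('n::finite \<Rightarrow> real) \<Rightarrow> 'w measure \<Rightarrow> ('n star \<Rightarrow> 'w measure) \<Rightarrow>
     (real \<Rightarrow> 'w \<Rightarrow> 'n star) \<Rightarrow> bool" where
  "star_BM p \<Omega> P Z \<longleftrightarrow>
     continuous_strong_Markov_process \<Omega> P Z \<and>
     has_generator P Z
       {f \<in> C02. (\<Sum>k\<in>UNIV. p k * d1_vertex f k) = 0}
       (\<lambda>f x. 1/2 * second_deriv f x)"

text \<open>First time in \<open>(0,\<infinity>)\<close> at which the process is in \<open>S\<close>; it is \<open>\<infinity>\<close> if there is none.\<close>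

definition hitting_time :: "(real \<Rightarrow> 'w \<Rightarrow> 's) \<Rightarrow> 's set \<Rightarrow> 'w \<Rightarrow> ennreal" where
  "hitting_time Z S \<omega> = Inf {ennreal t | t. 0 < t \<and> Z t \<omega> \<in> S}"

section \<open>The sticky operator\<close>

definition sticky_op :: "('n star \<Rightarrow> real) \<Rightarrow> 'n star \<Rightarrow> real" where
  "sticky_op f = second_deriv f"

definition sticky_vertex_condition ::
    "('n::finite \<Rightarrow> real) \<Rightarrow> real \<Rightarrow> real \<Rightarrow> ('n star \<Rightarrow> real) \<Rightarrow> bool" where
  "sticky_vertex_condition p b c f \<longleftrightarrow>
     1/2 * c * d2_vertex f = b * (\<Sum>k\<in>UNIV. p k * d1_vertex f k)"

text \<open>The domain of the sticky operator, and its version for functions that are only considered on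
  the closed ball of radius \<open>r\<close> around the vertex.\<close>

definition sticky_dom ::
    "('n::finite \<Rightarrow> real) \<Rightarrow> real \<Rightarrow> real \<Rightarrow> ('n star \<Rightarrow> real) set" where
  "sticky_dom p b c = {f \<in> C02. sticky_vertex_condition p b c f}"

definition sticky_dom_ball ::
    "('n::finite \<Rightarrow> real) \<Rightarrow> real \<Rightarrow> real \<Rightarrow> real \<Rightarrow> ('n star \<Rightarrow> real) set" where
  "sticky_dom_ball p b c r =
     {f. continuous_on (cball vertex r) f \<and> C2_on_rays {0<..<r} f \<and>
         (\<exists>l. \<forall>j. (d2 f j \<longlongrightarrow> l) (at_right 0)) \<and>
         sticky_vertex_condition p b c f}"

end

theory Submission
  imports Defs
begin

text \<open>On each ray a function killed by the operator is affine, and the vertex condition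
  \<open>\<Sum>k. p k * f_k'(0) = 0\<close> together with the boundary values \<open>1\<close> at \<open>ray e r\<close> and \<open>0\<close> at the other
  end points forces the value \<open>p e\<close> at the vertex.  So the only candidate is
  \<open>ball_harmonic p r e\<close>, with value \<open>p e + (of_bool (j = e) - p e) * x / r\<close> on ray \<open>j\<close>.  Since its
  second derivative vanishes, the sticky vertex condition reduces to the same balance of slopes.  It
  remains to see that this function is the exit probability \<open>u\<close>.

  Inside the ball this is optional stopping.  A function \<open>f\<close> in the domain of the generator that
  agrees with the candidate on the ball gives a martingale \<open>f (Z t)\<close> up to the exit from the ball
  (\<open>Dynkin_first_hit\<close>), whose value at the exit is the indicator of \<open>Z\<close> being at \<open>ray e r\<close>; the exit
  happens almost surely (\<open>reaches_sphere\<close>), because \<open>r\<^sup>2 - \<bar>Z t\<bar>\<^sup>2 + t\<close> is a martingale up to then.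
  On the sphere itself the hitting times only count positive times, so that there one needs
  regularity: started on the sphere, the process returns to it at arbitrarily small positive times
  (\<open>sphere_regular\<close>).  By continuity the early returns are to the starting point, which gives the
  boundary values \<open>1\<close> and \<open>0\<close>.

  Both probabilistic facts come from one estimate (\<open>avoidance_bound\<close>) for functions whose
  generator is \<open>-1\<close> on an open set.  Each function used has a constant generator off the set on which it is stopped.
  This is what makes Dynkin's formula elementary here: on a grid, the uniform convergence of the
  difference quotients of the semigroup and the Markov property at fixed times suffice.\<close>

section \<open>First hitting times of closed sets along a continuous path\<close>

text \<open>The time \<open>s\<close> is included and the value is capped at \<open>t\<close>.  A hitting time over the open interval
  \<open>(0,\<infinity>)\<close> looks into the immediate future at time \<open>0\<close> and is not a stopping time of the natural
  filtration; starting from a closed end \<open>s\<close> avoids this, and capping makes the time bounded.\<close>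

definition first_hit :: "(real \<Rightarrow> 'w \<Rightarrow> 's) \<Rightarrow> 's set \<Rightarrow> real \<Rightarrow> real \<Rightarrow> 'w \<Rightarrow> real" where
  "first_hit Z F s t \<omega> = Inf (insert t {v \<in> {s..t}. Z v \<omega> \<in> F})"

context
  fixes Z :: "real \<Rightarrow> 'w \<Rightarrow> 's::metric_space" and F :: "'s set" and s t :: real and \<omega> :: 'w
  assumes closed_F: "closed F"
    and path: "continuous_on {0..} (\<lambda>t. Z t \<omega>)"
    and s: "0 \<le> s" and st: "s \<le> t"
begin

lemma closed_hits: "closed {v \<in> {s..t}. Z v \<omega> \<in> F}"
proof -
  have "continuous_on {s..t} (\<lambda>t. Z t \<omega>)"
    using path by (rule continuous_on_subset) (use s in auto)
  then show ?thesis
    using continuous_closed_preimage[OF _ _ closed_F, of "{s..t}" "\<lambda>t. Z t \<omega>"]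
    by (simp add: vimage_def Int_def)
qed

lemma first_hit_mem: "first_hit Z F s t \<omega> \<in> insert t {v \<in> {s..t}. Z v \<omega> \<in> F}"
  unfolding first_hit_def
proof (rule closed_contains_Inf)
  show "bdd_below (insert t {v \<in> {s..t}. Z v \<omega> \<in> F})"
    using st by (intro bdd_belowI[of _ s]) auto
  show "closed (insert t {v \<in> {s..t}. Z v \<omega> \<in> F})"
    by (rule closed_insert[OF closed_hits])
qed simp

lemma first_hit_bounds: "s \<le> first_hit Z F s t \<omega>" "first_hit Z F s t \<omega> \<le> t"
  using first_hit_mem st by auto

lemma first_hit_le: "s \<le> v \<Longrightarrow> v \<le> t \<Longrightarrow> Z v \<omega> \<in> F \<Longrightarrow> first_hit Z F s t \<omega> \<le> v"
  unfolding first_hit_def using st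
  by (intro cInf_lower) (auto intro!: bdd_belowI[of _ s])

lemma before_first_hit: "s \<le> v \<Longrightarrow> v < first_hit Z F s t \<omega> \<Longrightarrow> Z v \<omega> \<notin> F"
  using first_hit_le[of v] first_hit_bounds by force

lemma first_hit_in: "s \<le> v \<Longrightarrow> v \<le> t \<Longrightarrow> Z v \<omega> \<in> F \<Longrightarrow> Z (first_hit Z F s t \<omega>) \<omega> \<in> F"
  using first_hit_le[of v] first_hit_mem by force

lemma less_first_hit_iff:
  assumes "s \<le> a" "a < t"
  shows "a < first_hit Z F s t \<omega> \<longleftrightarrow> (\<forall>v\<in>{s..a}. Z v \<omega> \<notin> F)"
proof
  assume "\<forall>v\<in>{s..a}. Z v \<omega> \<notin> F"
  then show "a < first_hit Z F s t \<omega>"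
    using first_hit_mem assms by force
qed (auto dest: before_first_hit[OF _ le_less_trans])

text \<open>Up to its first visit to \<open>F\<close> the path stays in the complement, so that by continuity it can
  only enter \<open>F\<close> through the closure of the complement.\<close>

lemma first_hit_in_closure:
  assumes "Z s \<omega> \<notin> F" "- F \<subseteq> K" "closed K"
  shows "Z (first_hit Z F s t \<omega>) \<omega> \<in> K"
proof (cases "first_hit Z F s t \<omega> = s")
  case True
  then show ?thesis using assms by auto
next
  case False
  define \<tau> where "\<tau> = first_hit Z F s t \<omega>"
  have lt: "s < \<tau>" using False first_hit_bounds(1) unfolding \<tau>_def by simp
  have "(\<lambda>t. Z t \<omega>) ` closure {s..<\<tau>} \<subseteq> K"
  proof (rule image_closure_subset)
    show "continuous_on (closure {s..<\<tau>}) (\<lambda>t. Z t \<omega>)"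
      using path by (rule continuous_on_subset) (use s lt in auto)
    show "(\<lambda>t. Z t \<omega>) ` {s..<\<tau>} \<subseteq> K"
      using before_first_hit assms(2) unfolding \<tau>_def by auto
  qed fact
  then show ?thesis using lt unfolding \<tau>_def by auto
qed

text \<open>Restricted to rational times, clamped to \<open>{s..t}\<close>, the distance to \<open>F\<close> comes arbitrarily
  close to its minimum, so that visits to \<open>F\<close> can be detected by countably many coordinates.\<close>

lemma hits_iff_rational:
  assumes "F \<noteq> {}"
  shows "(\<exists>v\<in>{s..t}. Z v \<omega> \<in> F) \<longleftrightarrow>
    (\<forall>n. \<exists>q\<in>\<rat>. infdist (Z (max s (min t q)) \<omega>) F < inverse (real (Suc n)))"
proof
  let ?D = "\<lambda>v. infdist (Z (max s (min t v)) \<omega>) F"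
  have cont: "continuous_on UNIV ?D"
    by (intro continuous_on_infdist continuous_on_compose2[OF path] continuous_intros)
      (use s in auto)
  {
    assume "\<exists>v\<in>{s..t}. Z v \<omega> \<in> F"
    then obtain v where v: "s \<le> v" "v \<le> t" "Z v \<omega> \<in> F" by auto
    show "\<forall>n. \<exists>q\<in>\<rat>. ?D q < inverse (real (Suc n))"
    proof
      fix n
      have "open {x. ?D x < inverse (real (Suc n))}"
        by (intro open_Collect_less cont continuous_intros)
      moreover have "v \<in> {x. ?D x < inverse (real (Suc n))}"
        using v by (simp add: infdist_zero)
      ultimately obtain d where d: "0 < d" "ball v d \<subseteq> {x. ?D x < inverse (real (Suc n))}"
        by (meson openE)
      obtain q where "q \<in> \<rat>" "v < q" "q < v + d"
        using Rats_dense_in_real[of v "v + d"] d(1) by auto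
      then show "\<exists>q\<in>\<rat>. ?D q < inverse (real (Suc n))"
        using d by (intro bexI[of _ q]) (auto simp: subset_iff dist_real_def)
    qed
  }
  {
    assume *: "\<forall>n. \<exists>q\<in>\<rat>. ?D q < inverse (real (Suc n))"
    have "continuous_on {s..t} (\<lambda>v. infdist (Z v \<omega>) F)"
      by (intro continuous_on_infdist continuous_on_subset[OF path]) (use s in auto)
    then obtain m where m: "m \<in> {s..t}"
      "\<And>v. v \<in> {s..t} \<Longrightarrow> infdist (Z m \<omega>) F \<le> infdist (Z v \<omega>) F"
      using continuous_attains_inf[of "{s..t}" "\<lambda>v. infdist (Z v \<omega>) F"] st by auto
    have "infdist (Z m \<omega>) F \<le> inverse (real (Suc n))" for n
    proof -
      obtain q where "?D q < inverse (real (Suc n))" using * by blast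
      moreover have "infdist (Z m \<omega>) F \<le> ?D q" by (rule m(2)) (use st in auto)
      ultimately show ?thesis by simp
    qed
    then have "infdist (Z m \<omega>) F \<le> 0"
      using LIMSEQ_le_const[OF LIMSEQ_inverse_real_of_nat] by blast
    then have "infdist (Z m \<omega>) F = 0" using infdist_nonneg[of "Z m \<omega>" F] by simp
    then have "Z m \<omega> \<in> F"
      using in_closure_iff_infdist_zero[OF assms] closed_F by (simp add: closure_closed)
    then show "\<exists>v\<in>{s..t}. Z v \<omega> \<in> F" using m(1) by blast
  }
qed

end

text \<open>This is \<open>first_hit\<close> rounded up to a grid of mesh \<open>(t - s) / n\<close>.  Counting the grid points before
  the hit, rather than rounding, turns a function of it into a telescoping sum over the events that
  the hit has not yet happened.\<close>

definition grid_hit :: "(real \<Rightarrow> 'w \<Rightarrow> 's) \<Rightarrow> 's set \<Rightarrow> real \<Rightarrow> real \<Rightarrow> nat \<Rightarrow> 'w \<Rightarrow> real" where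
  "grid_hit Z F s t n \<omega> =
     s + (t - s) / n * card {i. i < n \<and> s + (t - s) / n * i < first_hit Z F s t \<omega>}"

lemma sum_initial_segment:
  fixes a :: "nat \<Rightarrow> real"
  assumes "\<And>i j. i \<le> j \<Longrightarrow> Q j \<Longrightarrow> Q i"
  shows "(\<Sum>i<n. if Q i then a (Suc i) - a i else 0) = a (card {i. i < n \<and> Q i}) - a 0"
proof (induction n)
  case (Suc n)
  show ?case
  proof (cases "Q n")
    case True
    have "{i. i < n \<and> Q i} = {..<n}" "{i. i < Suc n \<and> Q i} = {..<Suc n}"
      using assms True by (auto simp: less_Suc_eq_le intro: less_imp_le)
    then show ?thesis using Suc True by simp
  next
    case False
    then have "{i. i < Suc n \<and> Q i} = {i. i < n \<and> Q i}" by (auto simp: less_Suc_eq)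
    then show ?thesis using Suc False by simp
  qed
qed simp

lemma card_initial_segment_bounds:
  fixes n :: nat
  assumes mono: "\<And>i j. i \<le> j \<Longrightarrow> Q j \<Longrightarrow> Q i"
  defines "N \<equiv> card {i. i < n \<and> Q i}"
  shows "N \<le> n" "N < n \<Longrightarrow> \<not> Q N" "0 < N \<Longrightarrow> Q (N - 1)"
proof -
  show "N \<le> n"
    unfolding N_def using card_mono[of "{..<n}" "{i. i < n \<and> Q i}"] by auto
  show "\<not> Q N" if "N < n"
  proof
    assume "Q N"
    then have "{..N} \<subseteq> {i. i < n \<and> Q i}" using mono that by auto
    then have "card {..N} \<le> N" unfolding N_def by (intro card_mono) auto
    then show False by simp
  qed
  show "Q (N - 1)" if "0 < N"
  proof (rule ccontr)
    assume "\<not> Q (N - 1)"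
    then have "{i. i < n \<and> Q i} \<subseteq> {..<N - 1}"
      using mono by (auto simp: not_le[symmetric])
    then have "N \<le> card {..<N - 1}" unfolding N_def by (intro card_mono) auto
    then show False using that by simp
  qed
qed

lemma grid_hit_bounds:
  fixes Z :: "real \<Rightarrow> 'w \<Rightarrow> 's::metric_space"
  assumes "closed F" "continuous_on {0..} (\<lambda>t. Z t \<omega>)" "0 \<le> s" "s \<le> t" "0 < n"
  shows "first_hit Z F s t \<omega> \<le> grid_hit Z F s t n \<omega>"
    "grid_hit Z F s t n \<omega> \<le> first_hit Z F s t \<omega> + (t - s) / n"
    "grid_hit Z F s t n \<omega> \<le> t" "s \<le> grid_hit Z F s t n \<omega>"
proof -
  define h where "h = (t - s) / n"
  define Q where "Q = (\<lambda>i. s + h * real i < first_hit Z F s t \<omega>)"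
  define N where "N = card {i. i < n \<and> Q i}"
  have h: "0 \<le> h" "h * n = t - s" unfolding h_def using assms by simp_all
  have mono: "Q i" if "i \<le> j" "Q j" for i j
    using mult_left_mono[OF _ h(1), of "real i" "real j"] that unfolding Q_def by auto
  have N: "N \<le> n" "N < n \<Longrightarrow> \<not> Q N" "0 < N \<Longrightarrow> Q (N - 1)"
    using card_initial_segment_bounds[of Q n, OF mono] unfolding N_def by auto
  note b = first_hit_bounds[of F Z \<omega> s t, OF assms(1-4)]
  have g: "grid_hit Z F s t n \<omega> = s + h * real N"
    unfolding grid_hit_def N_def Q_def h_def by simp
  show "first_hit Z F s t \<omega> \<le> grid_hit Z F s t n \<omega>"
  proof (cases "N < n")
    case True
    then show ?thesis using N(2) g unfolding Q_def by simp
  next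
    case False
    then have "N = n" using N(1) by simp
    then show ?thesis using g b h(2) by simp
  qed
  show "grid_hit Z F s t n \<omega> \<le> first_hit Z F s t \<omega> + (t - s) / n"
  proof (cases "0 < N")
    case True
    then have "s + h * (real N - 1) < first_hit Z F s t \<omega>"
      using N(3) unfolding Q_def by (simp add: of_nat_diff)
    then show ?thesis using g unfolding h_def[symmetric] by (simp add: algebra_simps)
  next
    case False
    then show ?thesis using g b h(1) unfolding h_def[symmetric] by simp
  qed
  have "h * real N \<le> h * real n" using N(1) h(1) by (intro mult_left_mono) auto
  then show "grid_hit Z F s t n \<omega> \<le> t" using g h(2) by simp
  show "s \<le> grid_hit Z F s t n \<omega>" using g h(1) by simp
qed

lemma tendsto_grid_hit:
  fixes Z :: "real \<Rightarrow> 'w \<Rightarrow> 's::metric_space"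
  assumes "closed F" "continuous_on {0..} (\<lambda>t. Z t \<omega>)" "0 \<le> s" "s \<le> t"
  shows "(\<lambda>n. grid_hit Z F s t (Suc n) \<omega>) \<longlonglongrightarrow> first_hit Z F s t \<omega>"
proof (rule tendsto_sandwich[where f = "\<lambda>_. first_hit Z F s t \<omega>"
      and h = "\<lambda>n. first_hit Z F s t \<omega> + (t - s) / real (Suc n)"])
  have "(\<lambda>n. first_hit Z F s t \<omega> + (t - s) * inverse (real (Suc n))) \<longlonglongrightarrow>
      first_hit Z F s t \<omega> + (t - s) * 0"
    by (intro tendsto_intros LIMSEQ_inverse_real_of_nat)
  then show "(\<lambda>n. first_hit Z F s t \<omega> + (t - s) / real (Suc n)) \<longlonglongrightarrow> first_hit Z F s t \<omega>"
    by (simp add: divide_inverse)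
qed (use grid_hit_bounds[of F Z \<omega> s t, OF assms] in \<open>auto intro!: always_eventually simp del: of_nat_Suc\<close>)

section \<open>Dynkin's formula\<close>

lemma C0_bounded: "f \<in> C0 \<Longrightarrow> \<exists>B\<ge>0. \<forall>x. \<bar>f x\<bar> \<le> B"
proof -
  assume f: "f \<in> C0"
  then obtain K where K: "compact K" "\<And>x. x \<notin> K \<Longrightarrow> \<bar>f x\<bar> < 1"
    unfolding C0_def by (auto dest: spec[of _ 1])
  have "continuous_on K f"
    using f unfolding C0_def by (auto intro: continuous_on_subset)
  then have "bounded (f ` K)"
    using K(1) compact_continuous_image compact_imp_bounded by blast
  then obtain B where B: "\<And>x. x \<in> K \<Longrightarrow> \<bar>f x\<bar> \<le> B"
    unfolding bounded_iff by auto
  have "\<bar>f x\<bar> \<le> max B 1" for x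
    using B[of x] K(2)[of x] by (cases "x \<in> K") auto
  then show ?thesis by (intro exI[of _ "max B 1"]) auto
qed

lemma C0_continuous: "f \<in> C0 \<Longrightarrow> continuous_on UNIV f"
  by (simp add: C0_def)

lemma space_natural_filtration: "space (natural_filtration \<Omega> Z t) = space \<Omega>"
  unfolding natural_filtration_def by (rule space_measure_of) auto

lemma sets_natural_filtration:
  "sets (natural_filtration \<Omega> Z t) =
     sigma_sets (space \<Omega>)
       {Z s -` B \<inter> space \<Omega> | s B. 0 \<le> s \<and> ennreal s \<le> t \<and> B \<in> sets borel}"
  unfolding natural_filtration_def by (rule sets_measure_of) auto

lemma filtration_natural: "filtration (space \<Omega>) (natural_filtration \<Omega> Z)"
proof
  show "sets (natural_filtration \<Omega> Z i) \<le> sets (natural_filtration \<Omega> Z j)" if "i \<le> j" for i j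
    unfolding sets_natural_filtration using that
    by (intro sigma_sets_mono') (auto intro: order_trans)
qed (rule space_natural_filtration)

lemma coordinate_natural_filtration:
  assumes "0 \<le> v" "v \<le> a"
  shows "Z v \<in> natural_filtration \<Omega> Z (ennreal a) \<rightarrow>\<^sub>M borel"
proof (rule measurableI)
  show "Z v -` B \<inter> space (natural_filtration \<Omega> Z (ennreal a))
      \<in> sets (natural_filtration \<Omega> Z (ennreal a))" if "B \<in> sets borel" for B
    unfolding space_natural_filtration sets_natural_filtration
    using assms that by (intro sigma_sets.Basic) (auto intro: ennreal_leI)
qed simp

context continuous_strong_Markov_process
begin

lemma space_P: "space (P x) = space \<Omega>"
  using sets_P by (rule sets_eq_imp_space_eq)

lemma measurable_P: "measurable (P x) N = measurable \<Omega> N"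
  using sets_P by (rule measurable_cong_sets) simp

lemma sets_natural_filtration_subset: "sets (natural_filtration \<Omega> Z t) \<subseteq> sets \<Omega>"
  unfolding sets_natural_filtration
proof (rule sets.sigma_sets_subset, safe)
  fix s :: real and B :: "'s set"
  assume "0 \<le> s" "B \<in> sets borel"
  then show "Z s -` B \<inter> space \<Omega> \<in> sets \<Omega>"
    using measurable_Z measurable_sets by blast
qed

text \<open>The Markov property at a fixed time is the strong one at a constant stopping time.\<close>

lemma Markov_property:
  assumes A: "A \<in> sets (natural_filtration \<Omega> Z (ennreal a))" and a: "0 \<le> a"
    and f: "f \<in> borel_measurable borel" "bounded (range f)" and t: "0 \<le> t"
  shows "(\<integral>\<omega>. indicator A \<omega> * f (Z (a + t) \<omega>) \<partial>P x) =
    (\<integral>\<omega>. indicator A \<omega> * semigroup P Z t f (Z a \<omega>) \<partial>P x)"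
proof -
  interpret N: filtration "space \<Omega>" "natural_filtration \<Omega> Z"
    by (rule filtration_natural)
  have st: "stopping_time (natural_filtration \<Omega> Z) (\<lambda>_. ennreal a)"
    by (rule stopping_time_const)
  have "A \<in> sets (N.pre_sigma (\<lambda>_. ennreal a))"
  proof (rule N.sets_pre_sigmaI[OF st])
    fix t
    show "{\<omega> \<in> A. ennreal a \<le> t} \<in> sets (natural_filtration \<Omega> Z t)"
      using A N.sets_F_mono[of "ennreal a" t] by (cases "ennreal a \<le> t") auto
  qed
  from strong_Markov[OF st this f t, of x] a show ?thesis by simp
qed

text \<open>The clamped rational times of \<open>hits_iff_rational\<close> all lie in \<open>{s..a}\<close>, so the event is known at
  time \<open>a\<close>.\<close>

lemma hits_natural_filtration:
  assumes F: "closed F" and "0 \<le> s" "s \<le> a"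
  shows "{\<omega> \<in> space \<Omega>. \<exists>v\<in>{s..a}. Z v \<omega> \<in> F} \<in> sets (natural_filtration \<Omega> Z (ennreal a))"
proof (cases "F = {}")
  case False
  let ?M = "natural_filtration \<Omega> Z (ennreal a)"
  have "{\<omega> \<in> space \<Omega>. \<exists>v\<in>{s..a}. Z v \<omega> \<in> F} =
    {\<omega> \<in> space ?M. \<forall>n. \<exists>q\<in>\<rat>. infdist (Z (max s (min a q)) \<omega>) F < inverse (real (Suc n))}"
    unfolding space_natural_filtration
    by (intro Collect_cong conj_cong refl hits_iff_rational[OF F _ assms(2,3) False]
        continuous_paths)
  also have "\<dots> \<in> sets ?M"
  proof -
    have [measurable]: "(\<lambda>\<omega>. infdist (Z (max s (min a q)) \<omega>) F) \<in> borel_measurable ?M" for q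
      using assms(2,3)
      by (intro borel_measurable_continuous_on[OF _ coordinate_natural_filtration]
          continuous_intros) auto
    have [simp]: "countable (\<rat> :: real set)" by (rule countable_rat)
    show ?thesis by measurable
  qed
  finally show ?thesis .
qed simp

lemma hits_measurable:
  assumes "closed F" "0 \<le> s"
  shows "{\<omega> \<in> space \<Omega>. \<exists>v\<in>{s..a}. Z v \<omega> \<in> F} \<in> sets \<Omega>"
proof (cases "s \<le> a")
  case True
  then show ?thesis
    using hits_natural_filtration[OF assms] sets_natural_filtration_subset by blast
qed simp

lemma avoids_natural_filtration:
  assumes "closed F" "0 \<le> s" "s \<le> a"
  shows "{\<omega> \<in> space \<Omega>. \<forall>v\<in>{s..a}. Z v \<omega> \<notin> F} \<in> sets (natural_filtration \<Omega> Z (ennreal a))"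
proof -
  have "{\<omega> \<in> space \<Omega>. \<forall>v\<in>{s..a}. Z v \<omega> \<notin> F} =
      space (natural_filtration \<Omega> Z (ennreal a)) - {\<omega> \<in> space \<Omega>. \<exists>v\<in>{s..a}. Z v \<omega> \<in> F}"
    unfolding space_natural_filtration by blast
  then show ?thesis using hits_natural_filtration[OF assms] by simp
qed

lemma avoids_measurable:
  assumes "closed F" "0 \<le> s"
  shows "{\<omega> \<in> space \<Omega>. \<forall>v\<in>{s..a}. Z v \<omega> \<notin> F} \<in> sets \<Omega>"
proof -
  have "{\<omega> \<in> space \<Omega>. \<forall>v\<in>{s..a}. Z v \<omega> \<notin> F} =
      space \<Omega> - {\<omega> \<in> space \<Omega>. \<exists>v\<in>{s..a}. Z v \<omega> \<in> F}" by blast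
  then show ?thesis using hits_measurable[OF assms] by simp
qed

lemma measurable_C0: "f \<in> C0 \<Longrightarrow> 0 \<le> t \<Longrightarrow> (\<lambda>\<omega>. f (Z t \<omega>)) \<in> borel_measurable \<Omega>"
  using measurable_Z by (intro borel_measurable_continuous_on[of f]) (auto dest: C0_continuous)

lemma integrable_bounded:
  assumes "f \<in> borel_measurable \<Omega>" "\<And>\<omega>. \<omega> \<in> space \<Omega> \<Longrightarrow> \<bar>f \<omega>\<bar> \<le> B"
  shows "integrable (P x) (f :: 'w \<Rightarrow> real)"
proof -
  interpret prob_space "P x" by (rule prob_space_P)
  show ?thesis
    using assms by (intro integrable_const_bound[of _ B]) (auto simp: space_P measurable_P)
qed

text \<open>By the Markov property the increment of \<open>f\<close> may be replaced by that of the semigroup, whose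
  difference quotient is uniformly close to the generator; hence the error is a multiple of \<open>h\<close>
  whatever the past event \<open>A\<close>, and summing over a grid loses only \<open>\<eta>\<close> times the total time.\<close>

lemma generator_increment:
  assumes sg: "\<And>t. 0 \<le> t \<Longrightarrow> semigroup P Z t f \<in> C0" and f: "f \<in> C0"
    and A: "A \<in> sets (natural_filtration \<Omega> Z (ennreal a))" "0 \<le> a" and h: "0 < h"
    and g: "\<And>\<omega>. \<omega> \<in> A \<Longrightarrow> g (Z a \<omega>) = \<gamma>"
    and err: "\<And>y. \<bar>(semigroup P Z h f y - f y) / h - g y\<bar> \<le> \<eta>"
  shows "\<bar>\<integral>\<omega>. indicator A \<omega> * (f (Z (a + h) \<omega>) - f (Z a \<omega>) - \<gamma> * h) \<partial>P x\<bar> \<le> h * \<eta>"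
proof -
  interpret prob_space "P x" by (rule prob_space_P)
  let ?S = "semigroup P Z h f"
  obtain B where B: "0 \<le> B" "\<And>y. \<bar>f y\<bar> \<le> B" using C0_bounded[OF f] by blast
  obtain B' where B': "0 \<le> B'" "\<And>y. \<bar>?S y\<bar> \<le> B'"
    using C0_bounded[OF sg[OF less_imp_le[OF h]]] by blast
  have AO[measurable]: "A \<in> sets \<Omega>" using A(1) sets_natural_filtration_subset by blast
  have AP: "A \<in> events" using AO sets_P by simp
  have [measurable]: "(\<lambda>\<omega>. f (Z a \<omega>)) \<in> borel_measurable \<Omega>"
    "(\<lambda>\<omega>. f (Z (a + h) \<omega>)) \<in> borel_measurable \<Omega>" "(\<lambda>\<omega>. ?S (Z a \<omega>)) \<in> borel_measurable \<Omega>"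
    using measurable_C0[OF f] measurable_C0[OF sg[of h]] A(2) h by auto
  have int: "integrable (P x) (\<lambda>\<omega>. indicator A \<omega> * f (Z (a + h) \<omega>))"
    "integrable (P x) (\<lambda>\<omega>. indicator A \<omega> * ?S (Z a \<omega>))"
    "integrable (P x) (\<lambda>\<omega>. indicator A \<omega> * (f (Z a \<omega>) + \<gamma> * h))"
  proof -
    show "integrable (P x) (\<lambda>\<omega>. indicator A \<omega> * f (Z (a + h) \<omega>))"
      by (rule integrable_bounded[of _ B]) (use B in \<open>auto simp: indicator_def\<close>)
    show "integrable (P x) (\<lambda>\<omega>. indicator A \<omega> * ?S (Z a \<omega>))"
      by (rule integrable_bounded[of _ B']) (use B' in \<open>auto simp: indicator_def\<close>)
    have "\<bar>f y + \<gamma> * h\<bar> \<le> B + \<bar>\<gamma> * h\<bar>" for y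
      using B(2)[of y] abs_triangle_ineq[of "f y" "\<gamma> * h"] by linarith
    then show "integrable (P x) (\<lambda>\<omega>. indicator A \<omega> * (f (Z a \<omega>) + \<gamma> * h))"
      by (intro integrable_bounded[of _ "B + \<bar>\<gamma> * h\<bar>"])
        (use B(1) in \<open>auto simp: indicator_def\<close>)
  qed
  have "(\<integral>\<omega>. indicator A \<omega> * (f (Z (a + h) \<omega>) - f (Z a \<omega>) - \<gamma> * h) \<partial>P x)
      = (\<integral>\<omega>. indicator A \<omega> * f (Z (a + h) \<omega>) \<partial>P x)
        - (\<integral>\<omega>. indicator A \<omega> * (f (Z a \<omega>) + \<gamma> * h) \<partial>P x)"
    using int by (subst Bochner_Integration.integral_diff[symmetric])
      (auto simp: algebra_simps)
  also have "(\<integral>\<omega>. indicator A \<omega> * f (Z (a + h) \<omega>) \<partial>P x) = (\<integral>\<omega>. indicator A \<omega> * ?S (Z a \<omega>) \<partial>P x)"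
  proof (rule Markov_property[OF A])
    show "f \<in> borel_measurable borel"
      using C0_continuous[OF f] by (rule borel_measurable_continuous_onI)
    show "bounded (range f)" using B(2) by (auto simp: bounded_iff)
  qed (use h in simp)
  also have "\<dots> - (\<integral>\<omega>. indicator A \<omega> * (f (Z a \<omega>) + \<gamma> * h) \<partial>P x)
      = (\<integral>\<omega>. indicator A \<omega> * ?S (Z a \<omega>) - indicator A \<omega> * (f (Z a \<omega>) + \<gamma> * h) \<partial>P x)"
    using int by (subst Bochner_Integration.integral_diff) auto
  also have "\<bar>\<dots>\<bar> \<le> (\<integral>\<omega>. \<bar>indicator A \<omega> * ?S (Z a \<omega>) - indicator A \<omega> * (f (Z a \<omega>) + \<gamma> * h)\<bar> \<partial>P x)"
    by (rule integral_abs_bound)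
  also have "\<dots> \<le> (\<integral>\<omega>. h * \<eta> \<partial>P x)"
  proof (rule integral_mono)
    fix \<omega>
    have eta: "0 \<le> \<eta>" using err[of undefined] by (rule order_trans[OF abs_ge_zero])
    show "\<bar>indicator A \<omega> * ?S (Z a \<omega>) - indicator A \<omega> * (f (Z a \<omega>) + \<gamma> * h)\<bar> \<le> h * \<eta>"
    proof (cases "\<omega> \<in> A")
      case True
      have "?S (Z a \<omega>) - (f (Z a \<omega>) + \<gamma> * h)
          = h * ((?S (Z a \<omega>) - f (Z a \<omega>)) / h - g (Z a \<omega>))"
        using h g[OF True] by (simp add: field_simps)
      then show ?thesis using True err[of "Z a \<omega>"] h by (simp add: abs_mult mult_left_mono)
    qed (use eta h in simp)
  qed (use int in auto)
  also have "\<dots> = h * \<eta>" by (simp add: prob_space)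
  finally show ?thesis .
qed

text \<open>The steps taken before the hit form an initial segment of the grid, so their increments
  telescope; each summand has the form treated in \<open>generator_increment\<close>.\<close>

lemma grid_hit_sum:
  assumes F: "closed F" and \<omega>: "\<omega> \<in> space \<Omega>" and st: "0 \<le> s" "s < t" and n: "0 < n"
  defines "h \<equiv> (t - s) / real n"
  shows "f (Z (grid_hit Z F s t n \<omega>) \<omega>) - f (Z s \<omega>) - \<gamma> * (grid_hit Z F s t n \<omega> - s) =
    (\<Sum>i<n. indicator {\<omega> \<in> space \<Omega>. \<forall>v\<in>{s..s + h * real i}. Z v \<omega> \<notin> F} \<omega> *
        (f (Z (s + h * real i + h) \<omega>) - f (Z (s + h * real i) \<omega>) - \<gamma> * h))"
proof -
  define Q where "Q = (\<lambda>i. s + h * real i < first_hit Z F s t \<omega>)"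
  define b where "b = (\<lambda>i. f (Z (s + h * real i) \<omega>) - \<gamma> * (h * real i))"
  have h: "0 < h" "h * real n = t - s" unfolding h_def using st n by simp_all
  have mono: "Q i" if "i \<le> j" "Q j" for i j
  proof -
    have "h * real i \<le> h * real j" using that(1) h(1) by (intro mult_left_mono) auto
    then show ?thesis using that(2) unfolding Q_def by linarith
  qed
  have "(\<Sum>i<n. indicator {\<omega> \<in> space \<Omega>. \<forall>v\<in>{s..s + h * real i}. Z v \<omega> \<notin> F} \<omega> *
        (f (Z (s + h * real i + h) \<omega>) - f (Z (s + h * real i) \<omega>) - \<gamma> * h))
      = (\<Sum>i<n. if Q i then b (Suc i) - b i else 0)"
  proof (rule sum.cong[OF refl])
    fix i assume "i \<in> {..<n}"
    then have "h * real i < h * real n" using h(1) by simp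
    also have "\<dots> = t - s" by (rule h(2))
    finally have "s + h * real i < t" by simp
    then have "Q i \<longleftrightarrow> (\<forall>v\<in>{s..s + h * real i}. Z v \<omega> \<notin> F)"
      unfolding Q_def using st h
      by (intro less_first_hit_iff[of F Z \<omega>, OF F continuous_paths[OF \<omega>]]) auto
    then show "indicator {\<omega> \<in> space \<Omega>. \<forall>v\<in>{s..s + h * real i}. Z v \<omega> \<notin> F} \<omega> *
        (f (Z (s + h * real i + h) \<omega>) - f (Z (s + h * real i) \<omega>) - \<gamma> * h)
        = (if Q i then b (Suc i) - b i else 0)"
      using \<omega> unfolding b_def by (auto simp: algebra_simps)
  qed
  also have "\<dots> = b (card {i. i < n \<and> Q i}) - b 0"
    by (rule sum_initial_segment) (rule mono)
  also have "\<dots> = f (Z (grid_hit Z F s t n \<omega>) \<omega>) - f (Z s \<omega>) - \<gamma> * (grid_hit Z F s t n \<omega> - s)"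
    unfolding b_def grid_hit_def Q_def h_def by simp
  finally show ?thesis by simp
qed

text \<open>Markov's property compares two single times, which is why the stopped increment is first
  evaluated on a grid and only then passed to the limit along the continuous paths.  A generator
  that is constant off \<open>F\<close> turns the time integral of the usual formula into a multiple of the
  elapsed time.\<close>

theorem Dynkin_first_hit:
  assumes gen: "has_generator P Z D G" and f: "f \<in> D" "f \<in> C0" "G f \<in> C0"
    and F: "closed F" and \<gamma>: "\<And>y. y \<notin> F \<Longrightarrow> G f y = \<gamma>" and st: "0 \<le> s" "s < t"
  defines "\<Delta> \<equiv> \<lambda>\<omega>. f (Z (first_hit Z F s t \<omega>) \<omega>) - f (Z s \<omega>) - \<gamma> * (first_hit Z F s t \<omega> - s)"
  shows "integrable (P x) \<Delta>" "(\<integral>\<omega>. \<Delta> \<omega> \<partial>P x) = 0"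
proof -
  interpret prob_space "P x" by (rule prob_space_P)
  have sg: "semigroup P Z t f \<in> C0" if "0 \<le> t" for t
    using gen f(2) that unfolding has_generator_def by blast
  have lim: "uniform_limit UNIV (\<lambda>t x. (semigroup P Z t f x - f x) / t) (G f) (at_right 0)"
    using gen f unfolding has_generator_def by blast
  obtain B where B: "\<And>y. \<bar>f y\<bar> \<le> B" using C0_bounded[OF f(2)] by blast
  define h where "h = (\<lambda>n. (t - s) / real (Suc n))"
  define A where "A = (\<lambda>n i. {\<omega> \<in> space \<Omega>. \<forall>v\<in>{s..s + h n * real i}. Z v \<omega> \<notin> F})"
  define \<xi> where "\<xi> = (\<lambda>n i \<omega>. indicator (A n i) \<omega> *
        (f (Z (s + h n * real i + h n) \<omega>) - f (Z (s + h n * real i) \<omega>) - \<gamma> * h n))"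
  define \<Delta>g where "\<Delta>g = (\<lambda>n \<omega>. f (Z (grid_hit Z F s t (Suc n) \<omega>) \<omega>) - f (Z s \<omega>)
      - \<gamma> * (grid_hit Z F s t (Suc n) \<omega> - s))"
  have h: "0 < h n" for n unfolding h_def using st by simp
  have sum: "\<Delta>g n \<omega> = (\<Sum>i<Suc n. \<xi> n i \<omega>)" if "\<omega> \<in> space \<Omega>" for n \<omega>
    using grid_hit_sum[OF F that st, of "Suc n" f \<gamma>]
    unfolding \<Delta>g_def \<xi>_def A_def h_def by simp
  have A: "A n i \<in> sets (natural_filtration \<Omega> Z (ennreal (s + h n * real i)))" for n i
    unfolding A_def using st less_imp_le[OF h] by (intro avoids_natural_filtration[OF F]) auto
  have [measurable]: "A n i \<in> sets \<Omega>" for n i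
    using A sets_natural_filtration_subset by blast
  have [measurable]: "(\<lambda>\<omega>. f (Z (s + h n * real i + h n) \<omega>)) \<in> borel_measurable \<Omega>"
    "(\<lambda>\<omega>. f (Z (s + h n * real i) \<omega>)) \<in> borel_measurable \<Omega>" for n i
    using st less_imp_le[OF h] by (auto intro!: measurable_C0[OF f(2)] add_nonneg_nonneg)
  have \<xi>_meas[measurable]: "\<xi> n i \<in> borel_measurable \<Omega>" for n i
    unfolding \<xi>_def by measurable
  have \<xi>_int: "integrable (P x) (\<xi> n i)" for n i
  proof (rule integrable_bounded[OF \<xi>_meas])
    show "\<bar>\<xi> n i \<omega>\<bar> \<le> 2 * B + \<bar>\<gamma> * h n\<bar>" for \<omega>
      using B[of "Z (s + h n * real i + h n) \<omega>"] B[of "Z (s + h n * real i) \<omega>"]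
      unfolding \<xi>_def by (auto simp: indicator_def)
  qed
  have meas_g: "\<Delta>g n \<in> borel_measurable (P x)" for n
  proof -
    have "(\<lambda>\<omega>. \<Sum>i<Suc n. \<xi> n i \<omega>) \<in> borel_measurable \<Omega>" by measurable
    then show ?thesis
      unfolding measurable_P by (subst measurable_cong[OF sum]) assumption
  qed
  have conv: "(\<lambda>n. \<Delta>g n \<omega>) \<longlonglongrightarrow> \<Delta> \<omega>" if \<omega>: "\<omega> \<in> space \<Omega>" for \<omega>
  proof -
    note path = continuous_paths[OF \<omega>]
    have g: "(\<lambda>n. grid_hit Z F s t (Suc n) \<omega>) \<longlonglongrightarrow> first_hit Z F s t \<omega>"
      using st by (intro tendsto_grid_hit[of F Z \<omega>, OF F path]) auto
    have nn: "0 \<le> grid_hit Z F s t (Suc n) \<omega>" "0 \<le> first_hit Z F s t \<omega>" for n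
      using grid_hit_bounds(4)[of F Z \<omega> s t, OF F path st(1), of "Suc n"]
        first_hit_bounds(1)[of F Z \<omega> s t, OF F path st(1)] st by auto
    have "continuous_on {0..} (\<lambda>t. f (Z t \<omega>))"
      using C0_continuous[OF f(2)] path by (rule continuous_on_compose2) auto
    then have "(\<lambda>n. f (Z (grid_hit Z F s t (Suc n) \<omega>) \<omega>)) \<longlonglongrightarrow> f (Z (first_hit Z F s t \<omega>) \<omega>)"
      using g by (rule continuous_on_tendsto_compose) (use nn in auto)
    then show ?thesis unfolding \<Delta>g_def \<Delta>_def by (intro tendsto_intros g)
  qed
  have bound: "\<bar>\<Delta>g n \<omega>\<bar> \<le> 2 * B + \<bar>\<gamma>\<bar> * (t - s)" if \<omega>: "\<omega> \<in> space \<Omega>" for n \<omega>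
  proof -
    have "\<bar>\<gamma> * (grid_hit Z F s t (Suc n) \<omega> - s)\<bar> \<le> \<bar>\<gamma>\<bar> * (t - s)"
      unfolding abs_mult
      using grid_hit_bounds(3,4)[of F Z \<omega> s t, OF F continuous_paths[OF \<omega>] st(1), of "Suc n"] st
      by (intro mult_left_mono) auto
    then show ?thesis
      using B[of "Z (grid_hit Z F s t (Suc n) \<omega>) \<omega>"] B[of "Z s \<omega>"] unfolding \<Delta>g_def by linarith
  qed
  have meas: "\<Delta> \<in> borel_measurable (P x)"
    by (rule borel_measurable_LIMSEQ_real[of _ \<Delta>g]) (use conv meas_g in \<open>auto simp: space_P\<close>)
  have "AE \<omega> in P x. (\<lambda>n. \<Delta>g n \<omega>) \<longlonglongrightarrow> \<Delta> \<omega>"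
    "AE \<omega> in P x. norm (\<Delta>g n \<omega>) \<le> 2 * B + \<bar>\<gamma>\<bar> * (t - s)" for n
    using conv bound by (auto simp: space_P)
  then have dc: "integrable (P x) \<Delta>" "(\<lambda>n. \<integral>\<omega>. \<Delta>g n \<omega> \<partial>P x) \<longlonglongrightarrow> (\<integral>\<omega>. \<Delta> \<omega> \<partial>P x)"
    using integrable_dominated_convergence[of \<Delta> "P x" \<Delta>g "\<lambda>_. 2 * B + \<bar>\<gamma>\<bar> * (t - s)"]
      integral_dominated_convergence[of \<Delta> "P x" \<Delta>g "\<lambda>_. 2 * B + \<bar>\<gamma>\<bar> * (t - s)"]
      meas meas_g by blast+
  show "integrable (P x) \<Delta>" by (rule dc(1))
  have "(\<lambda>n. \<integral>\<omega>. \<Delta>g n \<omega> \<partial>P x) \<longlonglongrightarrow> 0"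
  proof (rule LIMSEQ_I)
    fix \<epsilon> :: real assume \<epsilon>: "0 < \<epsilon>"
    define \<eta> where "\<eta> = (\<epsilon> / 2) / (t - s)"
    have "(t - s) * \<eta> = \<epsilon> / 2"
      unfolding \<eta>_def
      by (subst times_divide_eq_right, rule nonzero_mult_div_cancel_left) (use st in simp)
    then have \<eta>_less: "(t - s) * \<eta> < \<epsilon>" using \<epsilon> by linarith
    have \<eta>: "0 < \<eta>" unfolding \<eta>_def using \<epsilon> st by simp
    have "\<forall>\<^sub>F u in at_right 0. \<forall>y\<in>UNIV. dist ((semigroup P Z u f y - f y) / u) (G f y) < \<eta>"
      using lim \<eta> by (rule uniform_limitD)
    moreover have "filterlim h (at_right 0) sequentially"
      unfolding filterlim_at
    proof
      have "(\<lambda>n. (t - s) * inverse (real (Suc n))) \<longlonglongrightarrow> (t - s) * 0"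
        by (intro tendsto_intros LIMSEQ_inverse_real_of_nat)
      then show "h \<longlonglongrightarrow> 0" unfolding h_def by (simp add: divide_inverse)
    qed (use h in \<open>simp add: less_imp_neq[symmetric]\<close>)
    ultimately have "\<forall>\<^sub>F n in sequentially.
        \<forall>y\<in>UNIV. dist ((semigroup P Z (h n) f y - f y) / h n) (G f y) < \<eta>"
      by (rule eventually_compose_filterlim)
    then obtain N where
      "\<And>n y. N \<le> n \<Longrightarrow> dist ((semigroup P Z (h n) f y - f y) / h n) (G f y) < \<eta>"
      unfolding eventually_sequentially by blast
    then have N: "\<bar>(semigroup P Z (h n) f y - f y) / h n - G f y\<bar> \<le> \<eta>" if "N \<le> n" for n y
      using that by (auto simp: dist_real_def less_imp_le)
    have "norm ((\<integral>\<omega>. \<Delta>g n \<omega> \<partial>P x) - 0) < \<epsilon>" if n: "N \<le> n" for n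
    proof -
      have "(\<integral>\<omega>. \<Delta>g n \<omega> \<partial>P x) = (\<integral>\<omega>. (\<Sum>i<Suc n. \<xi> n i \<omega>) \<partial>P x)"
        by (rule Bochner_Integration.integral_cong) (auto simp: space_P sum simp del: sum.lessThan_Suc)
      also have "\<dots> = (\<Sum>i<Suc n. \<integral>\<omega>. \<xi> n i \<omega> \<partial>P x)"
        by (rule Bochner_Integration.integral_sum) (rule \<xi>_int)
      also have "\<bar>\<dots>\<bar> \<le> (\<Sum>i<Suc n. \<bar>\<integral>\<omega>. \<xi> n i \<omega> \<partial>P x\<bar>)" by (rule sum_abs)
      also have "\<dots> \<le> (\<Sum>i<Suc n. h n * \<eta>)"
      proof (rule sum_mono)
        fix i
        have le: "0 \<le> h n * real i" using h[of n] by simp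
        have end_free: "G f (Z (s + h n * real i) \<omega>) = \<gamma>" if "\<omega> \<in> A n i" for \<omega>
          using that le unfolding A_def by (intro \<gamma>) auto
        show "\<bar>\<integral>\<omega>. \<xi> n i \<omega> \<partial>P x\<bar> \<le> h n * \<eta>"
          unfolding \<xi>_def using st le
          by (intro generator_increment[OF sg f(2) A _ h end_free N[OF n]]) auto
      qed
      also have "\<dots> = (t - s) * \<eta>" unfolding h_def by (simp del: of_nat_Suc)
      finally show ?thesis using \<eta>_less by simp
    qed
    then show "\<exists>N. \<forall>n\<ge>N. norm ((\<integral>\<omega>. \<Delta>g n \<omega> \<partial>P x) - 0) < \<epsilon>" by blast
  qed
  then show "(\<integral>\<omega>. \<Delta> \<omega> \<partial>P x) = 0" using dc(2) LIMSEQ_unique by blast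
qed

end

section \<open>Hitting times in the open time interval\<close>

lemma hitting_time_eqI:
  assumes "0 < t" "Z t \<omega> \<in> S" "\<And>v. 0 < v \<Longrightarrow> v < t \<Longrightarrow> Z v \<omega> \<notin> S"
  shows "hitting_time Z S \<omega> = ennreal t"
  unfolding hitting_time_def
proof (rule antisym)
  show "Inf {ennreal t |t. 0 < t \<and> Z t \<omega> \<in> S} \<le> ennreal t"
    using assms by (intro Inf_lower) auto
  show "ennreal t \<le> Inf {ennreal t |t. 0 < t \<and> Z t \<omega> \<in> S}"
  proof (rule Inf_greatest)
    fix x assume "x \<in> {ennreal t |t. 0 < t \<and> Z t \<omega> \<in> S}"
    then obtain v where "x = ennreal v" "0 < v" "Z v \<omega> \<in> S" by blast
    then show "ennreal t \<le> x" using assms(3)[of v] by (cases "v < t") (auto intro: ennreal_leI)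
  qed
qed

lemma hitting_time_less_iff:
  "hitting_time Z S \<omega> < y \<longleftrightarrow> (\<exists>t>0. Z t \<omega> \<in> S \<and> ennreal t < y)"
  unfolding hitting_time_def Inf_less_iff by auto

text \<open>A finite positive hitting time is the limit of visits to \<open>C\<close> from the right.\<close>

lemma hitting_time_attained:
  fixes Z :: "real \<Rightarrow> 'w \<Rightarrow> 's::metric_space"
  assumes C: "closed C" and path: "continuous_on {0..} (\<lambda>t. Z t \<omega>)"
    and t: "0 < t" "hitting_time Z C \<omega> = ennreal t"
  shows "Z t \<omega> \<in> C"
proof -
  have "\<exists>v. t \<le> v \<and> v < t + inverse (real (Suc n)) \<and> Z v \<omega> \<in> C" for n
  proof -
    have "hitting_time Z C \<omega> < ennreal (t + inverse (real (Suc n)))"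
      using t by (simp add: ennreal_less_iff)
    then obtain v where v: "0 < v" "Z v \<omega> \<in> C" "ennreal v < ennreal (t + inverse (real (Suc n)))"
      unfolding hitting_time_less_iff by blast
    have "\<not> hitting_time Z C \<omega> < ennreal t" using t(2) by simp
    then have "\<not> ennreal v < ennreal t" unfolding hitting_time_less_iff using v(1,2) by blast
    then have "t \<le> v" using v(1) by (simp add: ennreal_less_iff not_less)
    moreover have "v < t + inverse (real (Suc n))"
      using v(1,3) by (subst (asm) ennreal_less_iff) auto
    ultimately show ?thesis using v(2) by blast
  qed
  then obtain v where v: "\<And>n. t \<le> v n" "\<And>n. v n < t + inverse (real (Suc n))"
    "\<And>n. Z (v n) \<omega> \<in> C" by metis
  have "v \<longlonglongrightarrow> t"
  proof (rule tendsto_sandwich[where f = "\<lambda>_. t" and h = "\<lambda>n. t + inverse (real (Suc n))"])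
    have "(\<lambda>n. t + inverse (real (Suc n))) \<longlonglongrightarrow> t + 0"
      by (intro tendsto_intros LIMSEQ_inverse_real_of_nat)
    then show "(\<lambda>n. t + inverse (real (Suc n))) \<longlonglongrightarrow> t" by simp
  qed (use v(1) less_imp_le[OF v(2)] in \<open>auto intro!: always_eventually\<close>)
  then have "(\<lambda>n. Z (v n) \<omega>) \<longlonglongrightarrow> Z t \<omega>"
    by (rule continuous_on_tendsto_compose[OF path])
      (use t(1) order_trans[OF less_imp_le[OF t(1)] v(1)] in \<open>auto intro!: always_eventually\<close>)
  with v(3) show ?thesis by (rule closed_sequentially[OF C])
qed

context continuous_strong_Markov_process
begin

text \<open>The hitting time is below \<open>y\<close> iff some interval with positive rational end points below \<open>y\<close>
  contains a visit.\<close>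

lemma hitting_time_measurable:
  assumes C: "closed C"
  shows "hitting_time Z C \<in> borel_measurable \<Omega>"
proof (rule borel_measurableI_less)
  fix y
  let ?I = "{q :: real \<times> real. fst q \<in> \<rat> \<and> snd q \<in> \<rat> \<and> 0 < fst q \<and> ennreal (snd q) < y}"
  have "{\<omega> \<in> space \<Omega>. hitting_time Z C \<omega> < y} =
      (\<Union>q\<in>?I. {\<omega> \<in> space \<Omega>. \<exists>v\<in>{fst q..snd q}. Z v \<omega> \<in> C})"
  proof (intro equalityI subsetI)
    fix \<omega> assume "\<omega> \<in> {\<omega> \<in> space \<Omega>. hitting_time Z C \<omega> < y}"
    then obtain t where t: "\<omega> \<in> space \<Omega>" "0 < t" "Z t \<omega> \<in> C" "ennreal t < y"
      unfolding hitting_time_less_iff by blast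
    obtain a where a: "a \<in> \<rat>" "0 < a" "a < t" using Rats_dense_in_real[OF t(2)] by blast
    obtain z where z: "ennreal t < z" "z < y" using dense[OF t(4)] by blast
    then obtain z' where z': "z = ennreal z'" "0 \<le> z'"
      by (cases z) (auto simp: top_unique)
    then have "t < z'" using z(1) t(2) by (simp add: ennreal_less_iff)
    then obtain b where b: "b \<in> \<rat>" "t < b" "b < z'" using Rats_dense_in_real by blast
    have "ennreal b < ennreal z'" using b t(2) by (subst ennreal_less_iff) auto
    then have "ennreal b < y" using z z' by auto
    then show "\<omega> \<in> (\<Union>q\<in>?I. {\<omega> \<in> space \<Omega>. \<exists>v\<in>{fst q..snd q}. Z v \<omega> \<in> C})"
      using a b t by (intro UN_I[of "(a, b)"]) (auto intro!: bexI[of _ t])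
  next
    fix \<omega> assume "\<omega> \<in> (\<Union>q\<in>?I. {\<omega> \<in> space \<Omega>. \<exists>v\<in>{fst q..snd q}. Z v \<omega> \<in> C})"
    then obtain a b v where "0 < a" "ennreal b < y" "\<omega> \<in> space \<Omega>" "a \<le> v" "v \<le> b" "Z v \<omega> \<in> C"
      by auto
    moreover from this have "ennreal v < y"
      using le_less_trans[OF ennreal_leI[of v b]] by blast
    ultimately show "\<omega> \<in> {\<omega> \<in> space \<Omega>. hitting_time Z C \<omega> < y}"
      unfolding hitting_time_less_iff by (auto intro!: exI[of _ v])
  qed
  also have "\<dots> \<in> sets \<Omega>"
  proof (rule sets.countable_UN')
    have "?I \<subseteq> \<rat> \<times> \<rat>" by auto
    then show "countable ?I"
      by (rule countable_subset) (intro countable_SIGMA countable_rat)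
  qed (use hits_measurable[OF C] in auto)
  finally show "{\<omega> \<in> space \<Omega>. hitting_time Z C \<omega> < y} \<in> sets \<Omega>" .
qed

section \<open>Escape estimates\<close>

text \<open>Stopped on \<open>F\<close>, the process \<open>f (Z v) + (v - s)\<close> is a martingale for \<open>v \<ge> s\<close>.  Off \<open>F\<close> it starts
  at \<open>f (Z s)\<close> and stays nonnegative; and it ends at \<open>c\<close> or above if the path does not meet \<open>S\<close>, since
  then either the whole time \<open>t - s\<close> has passed or the path has entered \<open>F\<close> at a point where
  \<open>f\<close> is at least \<open>c\<close>.  So a small value at time \<open>s\<close> makes a meeting with \<open>S\<close> likely.\<close>

lemma avoidance_bound:
  assumes gen: "has_generator P Z D G" and f: "f \<in> D" "f \<in> C0" "G f \<in> C0"
    and F: "closed F" and G: "\<And>y. y \<notin> F \<Longrightarrow> G f y = -1"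
    and K: "closed K" "- F \<subseteq> K" and S: "closed S"
    and pos: "\<And>y. y \<in> K \<Longrightarrow> 0 \<le> f y" and exit: "\<And>y. y \<in> K \<Longrightarrow> y \<in> F \<Longrightarrow> y \<notin> S \<Longrightarrow> c \<le> f y"
    and st: "0 \<le> s" "s < t" and c: "c \<le> t - s"
  shows "c * measure (P x) {\<omega> \<in> space \<Omega>. Z s \<omega> \<notin> F \<and> (\<forall>v\<in>{s..t}. Z v \<omega> \<notin> S)}
    \<le> (\<integral>\<omega>. \<bar>f (Z s \<omega>)\<bar> \<partial>P x)"
proof -
  interpret prob_space "P x" by (rule prob_space_P)
  define \<tau> where "\<tau> = first_hit Z F s t"
  define \<Delta> where "\<Delta> = (\<lambda>\<omega>. f (Z (\<tau> \<omega>) \<omega>) - f (Z s \<omega>) - (-1) * (\<tau> \<omega> - s))"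
  define N where "N = {\<omega> \<in> space \<Omega>. Z s \<omega> \<notin> F \<and> (\<forall>v\<in>{s..t}. Z v \<omega> \<notin> S)}"
  let ?g = "\<lambda>\<omega>. \<bar>f (Z s \<omega>)\<bar>"
  obtain B where B: "0 \<le> B" "\<And>y. \<bar>f y\<bar> \<le> B" using C0_bounded[OF f(2)] by blast
  have \<Delta>: "integrable (P x) \<Delta>" "expectation \<Delta> = 0"
    using Dynkin_first_hit[OF gen f F G st, of x] unfolding \<Delta>_def \<tau>_def by auto
  have [measurable]: "Z s \<in> \<Omega> \<rightarrow>\<^sub>M borel" by (rule measurable_Z[OF st(1)])
  have [measurable]: "F \<in> sets borel" "f \<in> borel_measurable borel"
    using F C0_continuous[OF f(2)] borel_measurable_continuous_onI by auto
  have "N = {\<omega> \<in> space \<Omega>. Z s \<omega> \<notin> F} \<inter> {\<omega> \<in> space \<Omega>. \<forall>v\<in>{s..t}. Z v \<omega> \<notin> S}"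
    unfolding N_def by auto
  then have N: "N \<in> sets \<Omega>" using avoids_measurable[OF S st(1), of t] by simp
  have int_g: "integrable (P x) ?g"
    by (rule integrable_bounded[of _ B]) (use B in auto)
  have int_N: "integrable (P x) (\<lambda>\<omega>. c * indicator N \<omega>)"
    by (rule integrable_bounded[of _ "\<bar>c\<bar>"]) (use N in \<open>auto simp: indicator_def\<close>)
  have "c * indicator N \<omega> \<le> \<Delta> \<omega> + ?g \<omega>" if \<omega>: "\<omega> \<in> space \<Omega>" for \<omega>
  proof -
    note path = continuous_paths[OF \<omega>]
    note b = first_hit_bounds[of F Z \<omega>, OF F path st(1) less_imp_le[OF st(2)]]
    show ?thesis
    proof (cases "Z s \<omega> \<in> F")
      case True
      have "\<tau> \<omega> = s"
        using first_hit_le[of F Z \<omega> s t s, OF F path st(1)] b(1) True st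
        unfolding \<tau>_def by simp
      then show ?thesis using True unfolding \<Delta>_def N_def by simp
    next
      case False
      have K': "Z (\<tau> \<omega>) \<omega> \<in> K"
        unfolding \<tau>_def using st
        by (intro first_hit_in_closure[of F Z \<omega>, OF F path _ _ False K(2,1)]) auto
      have le: "s \<le> \<tau> \<omega>" using b(1) unfolding \<tau>_def .
      have "c \<le> f (Z (\<tau> \<omega>) \<omega>) + (\<tau> \<omega> - s)" if "\<omega> \<in> N"
      proof (cases "Z (\<tau> \<omega>) \<omega> \<in> F")
        case True
        have "Z (\<tau> \<omega>) \<omega> \<notin> S" using that b unfolding N_def \<tau>_def by auto
        then show ?thesis using exit[OF K' True] le by simp
      next
        case False
        then have "\<tau> \<omega> = t"
          using first_hit_mem[of F Z \<omega> s t, OF F path st(1)] st unfolding \<tau>_def by auto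
        then show ?thesis using pos[OF K'] c by simp
      qed
      then show ?thesis
        using False pos[OF K'] le unfolding \<Delta>_def by (auto simp: indicator_def)
    qed
  qed
  then have "expectation (\<lambda>\<omega>. c * indicator N \<omega>) \<le> expectation (\<lambda>\<omega>. \<Delta> \<omega> + ?g \<omega>)"
    by (intro integral_mono int_N Bochner_Integration.integrable_add \<Delta>(1) int_g)
      (auto simp: space_P)
  also have "\<dots> = expectation ?g"
    using \<Delta> int_g by (subst Bochner_Integration.integral_add) auto
  also have "expectation (\<lambda>\<omega>. c * indicator N \<omega>) = c * prob N"
    using N sets_P by simp
  finally show ?thesis unfolding N_def .
qed

lemma expectation_tendsto_start:
  assumes \<psi>: "continuous_on UNIV \<psi>" "\<And>y. \<bar>\<psi> y\<bar> \<le> B"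
    and s: "\<And>n. 0 \<le> s n" "s \<longlonglongrightarrow> 0"
  shows "(\<lambda>n. \<integral>\<omega>. \<psi> (Z (s n) \<omega>) \<partial>P x) \<longlonglongrightarrow> (\<psi> x :: real)"
proof -
  interpret prob_space "P x" by (rule prob_space_P)
  have meas: "(\<lambda>\<omega>. \<psi> (Z t \<omega>)) \<in> borel_measurable (P x)" if "0 \<le> t" for t
    unfolding measurable_P using \<psi>(1) measurable_Z[OF that] by (rule borel_measurable_continuous_on)
  have "(\<lambda>n. expectation (\<lambda>\<omega>. \<psi> (Z (s n) \<omega>))) \<longlonglongrightarrow> expectation (\<lambda>\<omega>. \<psi> (Z 0 \<omega>))"
  proof (rule integral_dominated_convergence[where w = "\<lambda>_. B"])
    have "(\<lambda>n. \<psi> (Z (s n) \<omega>)) \<longlonglongrightarrow> \<psi> (Z 0 \<omega>)" if \<omega>: "\<omega> \<in> space \<Omega>" for \<omega>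
    proof -
      have "continuous_on {0..} (\<lambda>t. \<psi> (Z t \<omega>))"
        using \<psi>(1) continuous_paths[OF \<omega>] by (rule continuous_on_compose2) auto
      then show ?thesis by (rule continuous_on_tendsto_compose[OF _ s(2)]) (use s(1) in auto)
    qed
    then show "AE \<omega> in P x. (\<lambda>n. \<psi> (Z (s n) \<omega>)) \<longlonglongrightarrow> \<psi> (Z 0 \<omega>)"
      by (intro AE_I2) (simp add: space_P)
  qed (use meas s \<psi>(2) in auto)
  also have "expectation (\<lambda>\<omega>. \<psi> (Z 0 \<omega>)) = expectation (\<lambda>\<omega>. \<psi> x)"
    using start[of x] meas[of 0] by (intro integral_cong_AE) auto
  also have "\<dots> = \<psi> x" by (simp add: prob_space)
  finally show ?thesis .
qed

end

section \<open>Functions on the star graph\<close>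

lemma continuous_on_ray: "continuous_on {0..} (ray j)"
  unfolding continuous_on_iff by (force simp: dist_ray dist_real_def)

lemma closed_ray: "closed (ray j ` {0..})"
proof -
  have "open (- ray j ` {0..})"
    unfolding open_dist
  proof
    fix y assume y: "y \<in> - ray j ` {0..}"
    obtain k x where kx: "0 \<le> x" "y = ray k x" by (rule ray_cases[of y])
    have "x \<noteq> 0"
    proof
      assume "x = 0"
      then have "y = ray j 0" using kx by (simp add: ray_0)
      then show False using y by simp
    qed
    moreover have "k \<noteq> j" using y kx by auto
    ultimately have "x \<le> dist (ray j x') y" if "0 \<le> x'" for x'
      using kx that by (simp add: dist_ray)
    then have "\<forall>z. dist z y < x \<longrightarrow> z \<in> - ray j ` {0..}" by force
    then show "\<exists>e>0. \<forall>z. dist z y < e \<longrightarrow> z \<in> - ray j ` {0..}"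
      using kx \<open>x \<noteq> 0\<close> by (intro exI[of _ x]) auto
  qed
  then show ?thesis by (simp add: open_closed)
qed

lemma UNIV_star: "(\<Union>j. ray j ` {0..}) = UNIV"
proof (intro equalityI subsetI UNIV_I)
  fix y :: "'a star"
  obtain j x where "0 \<le> x" "y = ray j x" by (rule ray_cases[of y])
  then show "y \<in> (\<Union>j. ray j ` {0..})" by auto
qed

text \<open>The star graph is a finite union of closed rays, each an isometric copy of the half-line.\<close>

lemma continuous_on_starI:
  fixes f :: "'n::finite star \<Rightarrow> 'a::topological_space"
  assumes "\<And>j. continuous_on {0..} (\<lambda>x. f (ray j x))"
  shows "continuous_on UNIV f"
proof -
  have "continuous_on (\<Union>j. ray j ` {0..}) f"
  proof (rule continuous_on_closed_Union)
    fix j :: 'n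
    have "continuous_on (ray j ` {0..}) (\<lambda>y. f (ray j (dist vertex y)))"
      by (rule continuous_on_compose2[OF assms]) (auto intro: continuous_intros)
    then show "continuous_on (ray j ` {0..}) f"
      by (rule continuous_on_cong[THEN iffD1, rotated -1]) (auto simp: dist_vertex_ray)
  qed (auto intro: closed_ray)
  then show ?thesis by (simp add: UNIV_star)
qed

lemma compact_cball_vertex: "compact (cball (vertex :: 'n::finite star) M)"
proof -
  have "cball (vertex :: 'n star) M = (\<Union>j. ray j ` {0..M})"
  proof (intro equalityI subsetI)
    fix y :: "'n star" assume "y \<in> cball vertex M"
    moreover obtain j x where "0 \<le> x" "y = ray j x" by (rule ray_cases[of y])
    ultimately show "y \<in> (\<Union>j. ray j ` {0..M})"
      by (intro UN_I[of j]) (auto simp: dist_vertex_ray)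
  qed (auto simp: dist_vertex_ray)
  moreover have "compact (\<Union>j::'n. ray j ` {0..M})"
    by (intro compact_UN compact_continuous_image continuous_on_subset[OF continuous_on_ray]) auto
  ultimately show ?thesis by simp
qed

lemma C0_starI:
  fixes f :: "'n::finite star \<Rightarrow> real"
  assumes "\<And>j. continuous_on {0..} (\<lambda>x. f (ray j x))" "\<And>j x. M \<le> x \<Longrightarrow> f (ray j x) = 0"
    and "0 \<le> M"
  shows "f \<in> C0"
proof -
  have "f y = 0" if "y \<notin> cball vertex M" for y
  proof -
    obtain j x where "0 \<le> x" "y = ray j x" by (rule ray_cases[of y])
    then show ?thesis using that assms(2) by (auto simp: dist_vertex_ray)
  qed
  then show ?thesis
    unfolding C0_def
    using continuous_on_starI[OF assms(1)] compact_cball_vertex[of M]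
    by (auto intro!: exI[of _ "cball vertex M"])
qed

lemma d1_d2_eq:
  assumes "open I" and f: "\<And>x. x \<in> I \<Longrightarrow> f (ray j x) = g x"
    and g: "\<And>x. x \<in> I \<Longrightarrow> (g has_real_derivative g' x) (at x)"
    and g': "\<And>x. x \<in> I \<Longrightarrow> (g' has_real_derivative g'' x) (at x)"
    and x: "x \<in> I"
  shows "((\<lambda>x. f (ray j x)) has_real_derivative g' x) (at x)"
    "(d1 f j has_real_derivative g'' x) (at x)" "d1 f j x = g' x" "d2 f j x = g'' x"
proof -
  have D: "((\<lambda>x. f (ray j x)) has_real_derivative g' x) (at x)" if "x \<in> I" for x
    using g[OF that] \<open>open I\<close> that
    by (rule has_field_derivative_transform_within_open) (simp add: f)
  then have d1: "d1 f j x = g' x" if "x \<in> I" for x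
    unfolding d1_def using that by (intro DERIV_imp_deriv) auto
  have D2: "(d1 f j has_real_derivative g'' x) (at x)"
    using g'[OF x] \<open>open I\<close> x
    by (rule has_field_derivative_transform_within_open) (simp add: d1)
  show "((\<lambda>x. f (ray j x)) has_real_derivative g' x) (at x)"
    "(d1 f j has_real_derivative g'' x) (at x)" "d1 f j x = g' x" "d2 f j x = g'' x"
    using D[OF x] D2 d1[OF x] DERIV_imp_deriv[OF D2] unfolding d2_def by auto
qed

lemma C2_on_raysI:
  assumes "open I" "\<And>j x. x \<in> I \<Longrightarrow> f (ray j x) = g j x"
    and "\<And>j x. x \<in> I \<Longrightarrow> (g j has_real_derivative g' j x) (at x)"
    and "\<And>j x. x \<in> I \<Longrightarrow> (g' j has_real_derivative g'' j x) (at x)"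
    and cont: "\<And>j. continuous_on I (g'' j)"
  shows "C2_on_rays I f"
  unfolding C2_on_rays_def
proof (intro allI conjI)
  fix j
  have D: "((\<lambda>x. f (ray j x)) has_real_derivative g' j x) (at x)"
    "(d1 f j has_real_derivative g'' j x) (at x)" "d2 f j x = g'' j x" if "x \<in> I" for x
    using d1_d2_eq[of I f j "g j" "g' j" "g'' j" x] assms(1-4) that by auto
  show "(\<lambda>x. f (ray j x)) differentiable_on I"
  proof (rule differentiable_at_imp_differentiable_on)
    show "(\<lambda>x. f (ray j x)) differentiable at x" if "x \<in> I" for x
      unfolding real_differentiable_def using D(1)[OF that] by (rule exI)
  qed
  show "d1 f j differentiable_on I"
  proof (rule differentiable_at_imp_differentiable_on)
    show "d1 f j differentiable at x" if "x \<in> I" for x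
      unfolding real_differentiable_def using D(2)[OF that] by (rule exI)
  qed
  show "continuous_on I (d2 f j)"
    using cont[of j] by (rule continuous_on_cong[THEN iffD1, rotated -1]) (use D in auto)
qed

lemma
  assumes \<delta>: "0 < \<delta>" and f: "\<And>j x. 0 < x \<Longrightarrow> x < \<delta> \<Longrightarrow> f (ray j x) = g j x"
    and g: "\<And>j x. (g j has_real_derivative g' j x) (at x)"
    and g': "\<And>j x. (g' j has_real_derivative g'' j x) (at x)"
    and g'': "\<And>j. isCont (g'' j) 0" "\<And>j. g'' j 0 = l"
  shows d1_vertex_eq: "d1_vertex f j = g' j 0"
    and d2_tendsto: "(d2 f j \<longlongrightarrow> l) (at_right 0)" and d2_vertex_eq: "d2_vertex f = l"
proof -
  have D: "d1 f j x = g' j x" "d2 f j x = g'' j x" if "0 < x" "x < \<delta>" for j x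
    using d1_d2_eq(3,4)[of "{0<..<\<delta>}" f j "g j" "g' j" "g'' j" x] f g g' that by auto
  have near: "\<forall>\<^sub>F x in at_right 0. 0 < x \<and> x < \<delta>"
    using eventually_at_right[OF \<delta>] \<delta> by auto
  have "(g' j \<longlongrightarrow> g' j 0) (at_right 0)"
    using DERIV_isCont[OF g'[of j 0]] by (auto simp: isCont_def intro: tendsto_within_subset)
  moreover have "\<forall>\<^sub>F x in at_right 0. g' j x = d1 f j x"
    using near by eventually_elim (simp add: D)
  ultimately have "(d1 f j \<longlongrightarrow> g' j 0) (at_right 0)"
    by (rule Lim_transform_eventually)
  then show "d1_vertex f j = g' j 0"
    unfolding d1_vertex_def by (rule tendsto_Lim[rotated]) simp
  have lim: "(d2 f j \<longlongrightarrow> l) (at_right 0)" for j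
  proof (rule Lim_transform_eventually)
    show "(g'' j \<longlongrightarrow> l) (at_right 0)"
      using g''(1)[of j] g''(2)[of j] by (auto simp: isCont_def intro: tendsto_within_subset)
    show "\<forall>\<^sub>F x in at_right 0. g'' j x = d2 f j x"
      using near by eventually_elim (simp add: D)
  qed
  then show "(d2 f j \<longlongrightarrow> l) (at_right 0)" .
  show "d2_vertex f = l"
    unfolding d2_vertex_def
  proof (rule the_equality)
    show "m = l" if "\<forall>j. (d2 f j \<longlongrightarrow> m) (at_right 0)" for m
      using that lim[of undefined] tendsto_unique[of "at_right (0::real)"] by auto
  qed (use lim in blast)
qed

section \<open>Truncation\<close>

text \<open>From the second power on, \<open>ramp\<close> is differentiable at \<open>0\<close>; the third power is therefore twice
  continuously differentiable and serves to glue functions without leaving that class.\<close>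

definition ramp :: "nat \<Rightarrow> real \<Rightarrow> real" where
  "ramp k z = max 0 z ^ k"

lemma ramp_eq: "0 \<le> z \<Longrightarrow> ramp k z = z ^ k" "z \<le> 0 \<Longrightarrow> 0 < k \<Longrightarrow> ramp k z = 0"
  by (auto simp: ramp_def max_def)

lemma continuous_ramp [continuous_intros]:
  "continuous_on A f \<Longrightarrow> continuous_on A (\<lambda>x. ramp k (f x))"
  unfolding ramp_def by (intro continuous_intros)

lemma DERIV_ramp: "(ramp (Suc (Suc k)) has_real_derivative (2 + real k) * ramp (Suc k) z) (at z)"
proof -
  consider "z < 0" | "0 < z" | "z = 0" by linarith
  then show ?thesis
  proof cases
    case 1
    have "((\<lambda>_. 0) has_real_derivative (2 + real k) * ramp (Suc k) z) (at z)"
      using 1 by (simp add: ramp_eq)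
    then show ?thesis
      by (rule has_field_derivative_transform_within_open[of _ _ _ "{..<0}"])
        (use 1 in \<open>auto simp: ramp_eq\<close>)
  next
    case 2
    have "((\<lambda>z. z ^ Suc (Suc k)) has_real_derivative (2 + real k) * ramp (Suc k) z) (at z)"
      using 2 DERIV_pow[of "Suc (Suc k)" z] by (simp add: ramp_eq add.commute)
    then show ?thesis
      by (rule has_field_derivative_transform_within_open[of _ _ _ "{0<..}"])
        (use 2 in \<open>auto simp: ramp_eq\<close>)
  next
    case 3
    have "((\<lambda>h. ramp (Suc (Suc k)) h / h) \<longlongrightarrow> 0) (at 0)"
    proof (rule Lim_null_comparison)
      have "norm (ramp (Suc (Suc k)) h / h) \<le> \<bar>h\<bar> ^ Suc k" for h
        by (cases "0 \<le> h") (auto simp: ramp_eq mult_nonpos_nonneg)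
      then show "\<forall>\<^sub>F h in at 0. norm (ramp (Suc (Suc k)) h / h) \<le> \<bar>h\<bar> ^ Suc k"
        by (rule always_eventually[OF allI])
      have "((\<lambda>h::real. \<bar>h\<bar> ^ Suc k) \<longlongrightarrow> \<bar>0\<bar> ^ Suc k) (at 0)" by (intro tendsto_intros)
      then show "((\<lambda>h::real. \<bar>h\<bar> ^ Suc k) \<longlongrightarrow> 0) (at 0)" by simp
    qed
    then show ?thesis unfolding DERIV_def using 3 by (simp add: ramp_eq)
  qed
qed

lemma DERIV_ramp_3 [derivative_intros]:
  assumes "(f has_real_derivative D) (at x)"
  shows "((\<lambda>x. ramp 3 (f x)) has_real_derivative 3 * ramp 2 (f x) * D) (at x)"
  using DERIV_ramp[of 1 "f x"]
  by (intro DERIV_chain2[OF _ assms]) (simp add: numeral_3_eq_3 numeral_2_eq_2)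

lemma DERIV_ramp_2 [derivative_intros]:
  assumes "(f has_real_derivative D) (at x)"
  shows "((\<lambda>x. ramp 2 (f x)) has_real_derivative 2 * ramp 1 (f x) * D) (at x)"
  using DERIV_ramp[of 0 "f x"]
  by (intro DERIV_chain2[OF _ assms]) (simp add: numeral_2_eq_2)

text \<open>A twice continuously differentiable function that is \<open>1\<close> up to \<open>R\<close> and \<open>0\<close> from \<open>R + 1\<close> on,
  with its two derivatives.\<close>

definition cutoff :: "real \<Rightarrow> real \<Rightarrow> real" where
  "cutoff R x = ramp 3 (1 - ramp 3 (x - R))"

definition cutoff' :: "real \<Rightarrow> real \<Rightarrow> real" where
  "cutoff' R x = - 9 * ramp 2 (1 - ramp 3 (x - R)) * ramp 2 (x - R)"

definition cutoff'' :: "real \<Rightarrow> real \<Rightarrow> real" where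
  "cutoff'' R x = 54 * ramp 1 (1 - ramp 3 (x - R)) * (ramp 2 (x - R))\<^sup>2
     - 18 * ramp 2 (1 - ramp 3 (x - R)) * ramp 1 (x - R)"

lemma DERIV_cutoff: "(cutoff R has_real_derivative cutoff' R x) (at x)"
  unfolding cutoff_def[abs_def] cutoff'_def
  by (auto intro!: derivative_eq_intros simp: algebra_simps)

lemma DERIV_cutoff': "(cutoff' R has_real_derivative cutoff'' R x) (at x)"
  unfolding cutoff'_def[abs_def] cutoff''_def
  by (auto intro!: derivative_eq_intros simp: algebra_simps power2_eq_square)

lemma continuous_cutoff'': "continuous_on A (cutoff'' R)"
  unfolding cutoff''_def[abs_def] by (intro continuous_intros)

lemma cutoff_inside:
  "x \<le> R \<Longrightarrow> cutoff R x = 1" "x \<le> R \<Longrightarrow> cutoff' R x = 0" "x \<le> R \<Longrightarrow> cutoff'' R x = 0"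
  by (simp_all add: cutoff_def cutoff'_def cutoff''_def ramp_eq)

lemma cutoff_outside:
  assumes "R + 1 \<le> x"
  shows "cutoff R x = 0" "cutoff' R x = 0" "cutoff'' R x = 0"
proof -
  have "1 - ramp 3 (x - R) \<le> 0" using assms by (simp add: ramp_eq one_le_power)
  then show "cutoff R x = 0" "cutoff' R x = 0" "cutoff'' R x = 0"
    by (simp_all add: cutoff_def cutoff'_def cutoff''_def ramp_eq)
qed

text \<open>The domain of the generator is local: profiles on the rays that fit together at the vertex can
  be prescribed up to distance \<open>R\<close>.  Multiplying by the cutoff puts them into \<open>C0\<close>, and as
  \<open>R > 0\<close> the data at the vertex are unaffected.\<close>

lemma test_function_exists:
  fixes p :: "'n::finite \<Rightarrow> real"
  assumes R: "0 < R"
    and Q: "\<And>j x. (Q j has_real_derivative Q' j x) (at x)"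
    and Q': "\<And>j x. (Q' j has_real_derivative Q'' j x) (at x)"
    and cont: "\<And>j. continuous_on UNIV (Q'' j)"
    and vertex: "\<And>j. Q j 0 = a" "\<And>j. Q'' j 0 = l" "(\<Sum>k\<in>UNIV. p k * Q' k 0) = 0"
  shows "\<exists>f. f \<in> {f \<in> C02. (\<Sum>k\<in>UNIV. p k * d1_vertex f k) = 0} \<and> f \<in> C0 \<and>
    (\<lambda>x. 1/2 * second_deriv f x) \<in> C0 \<and>
    (\<forall>j x. 0 \<le> x \<longrightarrow> x \<le> R \<longrightarrow> f (ray j x) = Q j x \<and> second_deriv f (ray j x) = Q'' j x)"
proof -
  define f where "f = glue a (\<lambda>j x. Q j x * cutoff R x)"
  define g where "g = (\<lambda>j x. Q j x * cutoff R x)"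
  define g' where "g' = (\<lambda>j x. Q' j x * cutoff R x + Q j x * cutoff' R x)"
  define g'' where "g'' = (\<lambda>j x. Q'' j x * cutoff R x + 2 * Q' j x * cutoff' R x + Q j x * cutoff'' R x)"
  have f: "f (ray j x) = g j x" if "0 \<le> x" for j x
    using that R vertex(1)[of j] unfolding f_def g_def
    by (cases "x = 0") (auto simp: ray_0 glue_vertex glue_ray cutoff_inside)
  have Dg: "(g j has_real_derivative g' j x) (at x)" for j x
    unfolding g_def g'_def
    by (auto intro!: derivative_eq_intros Q DERIV_cutoff)
  have Dg': "(g' j has_real_derivative g'' j x) (at x)" for j x
    unfolding g'_def g''_def
    by (auto intro!: derivative_eq_intros Q Q' DERIV_cutoff DERIV_cutoff')
  have contQ: "continuous_on A (Q j)" "continuous_on A (Q' j)" "continuous_on A (Q'' j)"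
    "continuous_on A (cutoff R)" "continuous_on A (cutoff' R)" for j A
    using Q Q' cont DERIV_cutoff DERIV_cutoff'
    by (blast intro: DERIV_atLeastAtMost_imp_continuous_on continuous_at_imp_continuous_on
        DERIV_isCont continuous_on_subset)+
  have cg: "continuous_on A (g j)" "continuous_on A (g'' j)" for j A
    unfolding g_def g''_def by (intro continuous_intros contQ continuous_cutoff'')+
  have vert: "g j 0 = a" "g' j 0 = Q' j 0" "g'' j 0 = l" for j
    using R vertex unfolding g_def g'_def g''_def by (simp_all add: cutoff_inside)
  have out: "g j x = 0" "g'' j x = 0" if "R + 1 \<le> x" for j x
    using cutoff_outside[OF that] unfolding g_def g''_def by simp_all
  have C2: "C2_on_rays {0<..} f"
    using f Dg Dg' cg by (intro C2_on_raysI[of _ _ g g' g'']) auto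
  have d2: "d2 f j x = g'' j x" if "0 < x" for j x
    using d1_d2_eq(4)[of "{0<..}" f j "g j" "g' j" "g'' j" x] f Dg Dg' that by auto
  have fc: "\<And>j x. 0 < x \<Longrightarrow> x < 1 \<Longrightarrow> f (ray j x) = g j x" using f by simp
  have ic: "isCont (g'' j) 0" for j
    using cg(2)[of UNIV j] by (auto simp: continuous_on_eq_continuous_at)
  have dv: "d1_vertex f j = g' j 0" for j
    by (rule d1_vertex_eq[of 1 f g g' g'' l]) (use fc Dg Dg' ic vert(3) in auto)
  have d2v: "d2_vertex f = l"
    by (rule d2_vertex_eq[of 1 f g g' g'' l]) (use fc Dg Dg' ic vert(3) in auto)
  have sd: "second_deriv f (ray j x) = g'' j x" if "0 \<le> x" for j x
    using that vert(3)[of j] unfolding second_deriv_def d2v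
    by (cases "x = 0") (auto simp: ray_0 glue_vertex glue_ray d2)
  have C0: "f \<in> C0"
  proof (rule C0_starI[of _ "R + 1"])
    show "continuous_on {0..} (\<lambda>x. f (ray j x))" for j
      using cg(1) by (rule continuous_on_cong[THEN iffD1, rotated -1]) (auto simp: f)
  qed (use f out R in auto)
  have sdC0: "(\<lambda>y. c * second_deriv f y) \<in> C0" for c
  proof (rule C0_starI[of _ "R + 1"])
    have "continuous_on {0..} (\<lambda>x. c * g'' j x)" for j by (intro continuous_intros cg)
    then show "continuous_on {0..} (\<lambda>x. c * second_deriv f (ray j x))" for j
      by (rule continuous_on_cong[THEN iffD1, rotated -1]) (auto simp: sd)
  qed (use sd out R in auto)
  have "second_deriv f \<in> C0" using sdC0[of 1] by simp
  then have "f \<in> C02" unfolding C02_def using C0 C2 sd d2 by (auto intro!: bexI[of _ "second_deriv f"])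
  moreover have "(\<Sum>k\<in>UNIV. p k * d1_vertex f k) = 0" using vertex(3) by (simp add: dv vert)
  moreover have "f (ray j x) = Q j x \<and> second_deriv f (ray j x) = Q'' j x" if "0 \<le> x" "x \<le> R" for j x
    using that f sd unfolding g_def g''_def by (simp add: cutoff_inside)
  ultimately show ?thesis using C0 sdC0 by blast
qed

section \<open>Functions in the domain of the generator\<close>

abbreviation BM_domain :: "('n::finite \<Rightarrow> real) \<Rightarrow> ('n star \<Rightarrow> real) set" where
  "BM_domain p \<equiv> {f \<in> C02. (\<Sum>k\<in>UNIV. p k * d1_vertex f k) = 0}"

abbreviation BM_generator :: "('n star \<Rightarrow> real) \<Rightarrow> 'n star \<Rightarrow> real" where
  "BM_generator \<equiv> \<lambda>f x. 1/2 * second_deriv f x"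

text \<open>All slopes at the vertex are zero, so the vertex condition holds for any weights.\<close>

lemma squared_radius_function:
  fixes p :: "'n::finite \<Rightarrow> real"
  assumes r: "0 < r"
  shows "\<exists>f. f \<in> BM_domain p \<and> f \<in> C0 \<and> BM_generator f \<in> C0 \<and>
    (\<forall>y. dist vertex y \<le> r \<longrightarrow> f y = r\<^sup>2 - (dist vertex y)\<^sup>2 \<and> BM_generator f y = -1)"
proof -
  have "\<exists>f. f \<in> BM_domain p \<and> f \<in> C0 \<and> BM_generator f \<in> C0 \<and>
    (\<forall>j x. 0 \<le> x \<longrightarrow> x \<le> r \<longrightarrow> f (ray j x) = r\<^sup>2 - x\<^sup>2 \<and> second_deriv f (ray j x) = - 2)"
    by (rule test_function_exists[where Q' = "\<lambda>_ x. - 2 * x" and a = "r\<^sup>2" and l = "- 2"])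
      (use r in \<open>auto intro!: derivative_eq_intros\<close>)
  then obtain f where f: "f \<in> BM_domain p" "f \<in> C0" "BM_generator f \<in> C0"
    and *: "\<And>j x. 0 \<le> x \<Longrightarrow> x \<le> r \<Longrightarrow> f (ray j x) = r\<^sup>2 - x\<^sup>2 \<and> second_deriv f (ray j x) = -2"
    by blast
  have "f y = r\<^sup>2 - (dist vertex y)\<^sup>2 \<and> BM_generator f y = -1" if "dist vertex y \<le> r" for y
  proof -
    obtain j x where "0 \<le> x" "y = ray j x" by (rule ray_cases[of y])
    then show ?thesis using that *[of x j] by (simp add: dist_vertex_ray)
  qed
  then show ?thesis using f by blast
qed

text \<open>The counterpart for the outside of the sphere vanishes at radius \<open>r\<close>, is positive beyond it and
  has generator \<open>-1\<close> there.  To belong to the domain it must also be continued to the vertex.\<close>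

lemma outer_shell_function:
  fixes p :: "'n::finite \<Rightarrow> real"
  assumes r: "0 < r"
  shows "\<exists>f. f \<in> BM_domain p \<and> f \<in> C0 \<and> BM_generator f \<in> C0 \<and>
    (\<forall>y. r \<le> dist vertex y \<longrightarrow> dist vertex y \<le> 2 * r \<longrightarrow>
      f y = (dist vertex y - r) * (3 * r - dist vertex y) \<and> BM_generator f y = -1)"
proof -
  \<comment> \<open>The parabola has slope \<open>4 * r\<close> at \<open>0\<close>.  The second summand vanishes from \<open>r\<close> on, and its
    coefficient is chosen to cancel this slope.\<close>
  let ?Q = "\<lambda>x. (x - r) * (3 * r - x) + 4 / (3 * r) * ramp 3 (r - x)"
  let ?Q' = "\<lambda>x. 4 * r - 2 * x - 4 / r * ramp 2 (r - x)"
  let ?Q'' = "\<lambda>x. - 2 + 8 / r * ramp 1 (r - x)"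
  have "(?Q has_real_derivative ?Q' x) (at x)" "(?Q' has_real_derivative ?Q'' x) (at x)" for x
    using r by (auto intro!: derivative_eq_intros simp: field_simps)
  moreover have "continuous_on UNIV ?Q''" by (intro continuous_intros)
  moreover have "?Q' 0 = 0" "?Q'' 0 = 6" using r by (simp_all add: ramp_eq power2_eq_square)
  ultimately have "\<exists>f. f \<in> BM_domain p \<and> f \<in> C0 \<and> BM_generator f \<in> C0 \<and>
    (\<forall>j x. 0 \<le> x \<longrightarrow> x \<le> 2 * r \<longrightarrow> f (ray j x) = ?Q x \<and> second_deriv f (ray j x) = ?Q'' x)"
    using r
    by (intro test_function_exists[where Q = "\<lambda>_. ?Q" and Q' = "\<lambda>_. ?Q'" and Q'' = "\<lambda>_. ?Q''"
          and a = "?Q 0" and l = 6]) simp_all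
  then obtain f where f: "f \<in> BM_domain p" "f \<in> C0" "BM_generator f \<in> C0"
    and *: "\<And>j x. 0 \<le> x \<Longrightarrow> x \<le> 2 * r \<Longrightarrow> f (ray j x) = ?Q x \<and> second_deriv f (ray j x) = ?Q'' x"
    by blast
  have "f y = (dist vertex y - r) * (3 * r - dist vertex y) \<and> BM_generator f y = -1"
    if "r \<le> dist vertex y" "dist vertex y \<le> 2 * r" for y
  proof -
    obtain j x where "0 \<le> x" "y = ray j x" by (rule ray_cases[of y])
    then show ?thesis using that *[of x j] by (simp add: dist_vertex_ray ramp_eq)
  qed
  then show ?thesis using f by blast
qed

definition ball_harmonic :: "('n \<Rightarrow> real) \<Rightarrow> real \<Rightarrow> 'n \<Rightarrow> 'n \<Rightarrow> real \<Rightarrow> real" where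
  "ball_harmonic p r e j x = p e + (of_bool (j = e) - p e) / r * x"

lemma ball_harmonic_DERIV:
  "(ball_harmonic p r e j has_real_derivative (of_bool (j = e) - p e) / r) (at x)"
proof -
  have "((\<lambda>x. p e + k * x) has_real_derivative k) (at x)" for k
    by (auto intro!: derivative_eq_intros)
  then show ?thesis unfolding ball_harmonic_def[abs_def] .
qed

text \<open>The value \<open>p e\<close> at the vertex is the one for which the weighted slopes cancel.\<close>

lemma ball_harmonic_balance:
  fixes p :: "'n::finite \<Rightarrow> real"
  assumes "(\<Sum>k\<in>UNIV. p k) = 1"
  shows "(\<Sum>k\<in>UNIV. p k * ((of_bool (k = e) - p e) / r)) = 0"
proof -
  have "(\<Sum>k\<in>UNIV. p k * ((of_bool (k = e) - p e) / r))
      = ((\<Sum>k\<in>UNIV. p k * of_bool (k = e)) - (\<Sum>k\<in>UNIV. p k) * p e) / r"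
    by (simp add: sum_divide_distrib[symmetric] right_diff_distrib sum_subtractf sum_distrib_right)
  also have "(\<Sum>k\<in>UNIV. p k * of_bool (k = e)) = p e"
    by (simp add: of_bool_def if_distrib[of "(*) _"] cong: if_cong)
  finally show ?thesis using assms by simp
qed

lemma harmonic_function:
  fixes p :: "'n::finite \<Rightarrow> real"
  assumes r: "0 < r" and p: "(\<Sum>k\<in>UNIV. p k) = 1"
  shows "\<exists>f. f \<in> BM_domain p \<and> f \<in> C0 \<and> BM_generator f \<in> C0 \<and>
    (\<forall>j x. 0 \<le> x \<longrightarrow> x \<le> r \<longrightarrow> f (ray j x) = ball_harmonic p r e j x) \<and>
    (\<forall>y. dist vertex y \<le> r \<longrightarrow> BM_generator f y = 0)"
proof -
  have "\<exists>f. f \<in> BM_domain p \<and> f \<in> C0 \<and> BM_generator f \<in> C0 \<and>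
    (\<forall>j x. 0 \<le> x \<longrightarrow> x \<le> r \<longrightarrow>
      f (ray j x) = ball_harmonic p r e j x \<and> second_deriv f (ray j x) = 0)"
    by (rule test_function_exists[OF r ball_harmonic_DERIV DERIV_const _ _ _
          ball_harmonic_balance[OF p]]) (simp_all add: ball_harmonic_def)
  then obtain f where f: "f \<in> BM_domain p" "f \<in> C0" "BM_generator f \<in> C0"
    and *: "\<And>j x. 0 \<le> x \<Longrightarrow> x \<le> r \<Longrightarrow>
      f (ray j x) = ball_harmonic p r e j x \<and> second_deriv f (ray j x) = 0"
    by blast
  have "BM_generator f y = 0" if "dist vertex y \<le> r" for y
  proof -
    obtain j x where "0 \<le> x" "y = ray j x" by (rule ray_cases[of y])
    then show ?thesis using that *[of x j] by (simp add: dist_vertex_ray)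
  qed
  then show ?thesis using f * by blast
qed

section \<open>The sphere\<close>

lemma closed_radius:
  "closed {y :: 'a::metric_space. r \<le> dist v y}" "closed {y. dist v y \<le> r}" "closed {y. dist v y = r}"
  by (intro closed_Collect_le closed_Collect_eq continuous_intros)+

lemma dist_sphere: "0 < r \<Longrightarrow> dist (ray j r) (ray k r) = (if j = k then 0 else 2 * r)"
  by (simp add: dist_ray)

lemma sphere_cases:
  assumes "dist vertex y = r"
  obtains j where "y = ray j r"
proof -
  obtain j x where "0 \<le> x" "y = ray j x" by (rule ray_cases[of y])
  then show thesis using assms that by (auto simp: dist_vertex_ray)
qed

lemma ray_eq_iff: "0 < r \<Longrightarrow> ray j r = ray k r \<longleftrightarrow> j = k"
  using dist_sphere[of r j k] by (auto split: if_splits)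

text \<open>A path from inside the ball first meets the sphere at a single point.  A hitting time of the
  point \<open>ray e r\<close> equal to that of the sphere is attained, hence means that the path is at
  \<open>ray e r\<close> then.\<close>

lemma exit_point:
  fixes Z :: "real \<Rightarrow> 'w \<Rightarrow> 'n star"
  assumes path: "continuous_on {0..} (\<lambda>t. Z t \<omega>)" and r: "0 < r"
    and in_ball: "dist vertex (Z 0 \<omega>) < r" and v: "0 \<le> v" "v \<le> t" "dist vertex (Z v \<omega>) = r"
  defines "\<tau> \<equiv> first_hit Z {y. r \<le> dist vertex y} 0 t \<omega>"
  shows "dist vertex (Z \<tau> \<omega>) = r"
    "hitting_time Z {y. dist vertex y = r} \<omega> = hitting_time Z {ray e r} \<omega> \<longleftrightarrow> Z \<tau> \<omega> = ray e r"
proof -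
  let ?F = "{y :: 'n star. r \<le> dist vertex y}"
  have t: "0 \<le> t" using v by simp
  note F = closed_radius(1)[of r "vertex :: 'n star"]
  have 1: "r \<le> dist vertex (Z \<tau> \<omega>)"
    using first_hit_in[of ?F Z \<omega> 0 t v, OF F path order_refl t v(1,2)] v(3) unfolding \<tau>_def by simp
  have 2: "Z \<tau> \<omega> \<in> {y. dist vertex y \<le> r}"
    unfolding \<tau>_def
    by (rule first_hit_in_closure[of ?F Z \<omega> 0 t, OF F path order_refl t _ _ closed_radius(2)])
      (use in_ball in auto)
  show rad: "dist vertex (Z \<tau> \<omega>) = r" using 1 2 by simp
  have before: "dist vertex (Z w \<omega>) < r" if "0 \<le> w" "w < \<tau>" for w
    using before_first_hit[of ?F Z \<omega> 0 t w, OF F path order_refl t that(1)] that(2)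
    unfolding \<tau>_def by simp
  have "0 \<le> \<tau>"
    using first_hit_bounds(1)[of ?F Z \<omega> 0 t, OF F path order_refl t] unfolding \<tau>_def .
  moreover have "\<tau> \<noteq> 0" using rad in_ball by auto
  ultimately have \<tau>: "0 < \<tau>" by simp
  have S: "hitting_time Z {y. dist vertex y = r} \<omega> = ennreal \<tau>"
    using \<tau> rad by (intro hitting_time_eqI) (auto dest: before[OF less_imp_le])
  show "hitting_time Z {y. dist vertex y = r} \<omega> = hitting_time Z {ray e r} \<omega> \<longleftrightarrow> Z \<tau> \<omega> = ray e r"
  proof
    assume "hitting_time Z {y. dist vertex y = r} \<omega> = hitting_time Z {ray e r} \<omega>"
    then show "Z \<tau> \<omega> = ray e r"
      using hitting_time_attained[of "{ray e r}" Z \<omega> \<tau>, OF _ path \<tau>] S by simp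
  next
    assume "Z \<tau> \<omega> = ray e r"
    moreover have "Z w \<omega> \<noteq> ray e r" if "0 < w" "w < \<tau>" for w
      using before[of w] that r by (auto simp: dist_vertex_ray)
    ultimately have "hitting_time Z {ray e r} \<omega> = ennreal \<tau>"
      using \<tau> by (intro hitting_time_eqI) auto
    then show "hitting_time Z {y. dist vertex y = r} \<omega> = hitting_time Z {ray e r} \<omega>" using S by simp
  qed
qed

section \<open>Brownian motion and the sphere\<close>

context
  fixes p :: "'n::finite \<Rightarrow> real" and \<Omega> :: "'w measure" and P :: "'n star \<Rightarrow> 'w measure"
    and Z :: "real \<Rightarrow> 'w \<Rightarrow> 'n star" and r :: real
  assumes BM: "star_BM p \<Omega> P Z" and r: "0 < r"
begin

interpretation continuous_strong_Markov_process \<Omega> P Z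
  using BM unfolding star_BM_def by blast

lemma generator: "has_generator P Z (BM_domain p) BM_generator"
  using BM unfolding star_BM_def by blast

text \<open>The bound of \<open>avoidance_bound\<close> does not depend on the length \<open>n\<close> of the time interval, so the
  probability of staying inside up to time \<open>n\<close> is \<open>O(1/n)\<close>.\<close>

lemma reaches_sphere:
  assumes x: "dist vertex x < r"
  shows "AE \<omega> in P x. \<exists>v\<ge>0. dist vertex (Z v \<omega>) = r"
proof -
  interpret prob_space "P x" by (rule prob_space_P)
  let ?S = "{y :: 'n star. dist vertex y = r}" and ?F = "{y :: 'n star. r \<le> dist vertex y}"
  obtain f where f: "f \<in> BM_domain p" "f \<in> C0" "BM_generator f \<in> C0"
    and fv: "\<And>y. dist vertex y \<le> r \<Longrightarrow> f y = r\<^sup>2 - (dist vertex y)\<^sup>2"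
      "\<And>y. dist vertex y \<le> r \<Longrightarrow> BM_generator f y = -1"
    using squared_radius_function[OF r, of p] by blast
  define N where
    "N = (\<lambda>n. {\<omega> \<in> space \<Omega>. Z 0 \<omega> \<notin> ?F \<and> (\<forall>v\<in>{0..real (Suc n)}. Z v \<omega> \<notin> ?S)})"
  have meas: "N n \<in> events" for n
  proof -
    have "N n = (Z 0 -` (- ?F) \<inter> space \<Omega>)
        \<inter> {\<omega> \<in> space \<Omega>. \<forall>v\<in>{0..real (Suc n)}. Z v \<omega> \<notin> ?S}"
      unfolding N_def by auto
    moreover have "Z 0 -` (- ?F) \<inter> space \<Omega> \<in> sets \<Omega>"
      by (intro measurable_sets[OF measurable_Z] borel_comp borel_closed closed_radius) simp
    ultimately show ?thesis
      using avoids_measurable[OF closed_radius(3), of 0] sets_P by auto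
  qed
  define C where "C = (\<integral>\<omega>. \<bar>f (Z 0 \<omega>)\<bar> \<partial>P x)"
  have bound: "real (Suc n) * prob (N n) \<le> C" for n
    unfolding N_def C_def
    by (rule avoidance_bound[OF generator f closed_radius(1) _ closed_radius(2)[of vertex r] _
          closed_radius(3)]) (use fv in \<open>auto simp: power_mono\<close>)
  have "prob (\<Inter>n. N n) \<le> C * inverse (real (Suc n))" for n
  proof -
    have "prob (\<Inter>n. N n) \<le> prob (N n)" using meas by (intro finite_measure_mono) auto
    also have "\<dots> \<le> C * inverse (real (Suc n))"
      using bound[of n] by (simp add: field_simps)
    finally show ?thesis .
  qed
  moreover have "(\<lambda>n. C * inverse (real (Suc n))) \<longlonglongrightarrow> C * 0"
    by (intro tendsto_intros LIMSEQ_inverse_real_of_nat)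
  ultimately have "prob (\<Inter>n. N n) \<le> C * 0" by (intro LIMSEQ_le_const) auto
  then have "prob (\<Inter>n. N n) = 0" by (simp add: measure_le_0_iff)
  then have "AE \<omega> in P x. \<omega> \<notin> (\<Inter>n. N n)"
    using meas by (subst (asm) prob_eq_0) auto
  then show ?thesis
    using start[of x] AE_space
  proof eventually_elim
    case (elim \<omega>)
    then obtain n where "\<omega> \<notin> N n" by blast
    then show ?case using elim x unfolding N_def by (auto simp: space_P)
  qed
qed

text \<open>Shortly after the start, at time \<open>s\<close>, the process is on the sphere, inside it, in the shell
  between the radii \<open>r\<close> and \<open>2 * r\<close>, or further out.  Inside and in the shell, \<open>avoidance_bound\<close>
  applies with a function that vanishes on the sphere, so that its expected value at time \<open>s\<close>
  tends to \<open>0\<close> with \<open>s\<close>; and by continuity it is unlikely to be further out.  Restarting at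
  \<open>s > 0\<close> keeps to stopping times of the natural filtration.\<close>

lemma sphere_regular:
  assumes x: "dist vertex x = r" and t: "0 < t"
  shows "AE \<omega> in P x. \<exists>v. 0 < v \<and> v \<le> t \<and> dist vertex (Z v \<omega>) = r"
proof -
  interpret prob_space "P x" by (rule prob_space_P)
  let ?S = "{y :: 'n star. dist vertex y = r}"
  let ?Fi = "{y :: 'n star. r \<le> dist vertex y}"
  let ?Fo = "{y :: 'n star. dist vertex y \<le> r} \<union> {y. 2 * r \<le> dist vertex y}"
  let ?Ko = "{y :: 'n star. r \<le> dist vertex y} \<inter> {y. dist vertex y \<le> 2 * r}"
  have closed_Fo: "closed ?Fo" and closed_Ko: "closed ?Ko"
    by (intro closed_Un closed_Int closed_radius)+
  obtain f where f: "f \<in> BM_domain p" "f \<in> C0" "BM_generator f \<in> C0"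
    and fv: "\<And>y. dist vertex y \<le> r \<Longrightarrow> f y = r\<^sup>2 - (dist vertex y)\<^sup>2"
      "\<And>y. dist vertex y \<le> r \<Longrightarrow> BM_generator f y = -1"
    using squared_radius_function[OF r, of p] by blast
  obtain g where g: "g \<in> BM_domain p" "g \<in> C0" "BM_generator g \<in> C0"
    and gv: "\<And>y. r \<le> dist vertex y \<Longrightarrow> dist vertex y \<le> 2 * r \<Longrightarrow>
        g y = (dist vertex y - r) * (3 * r - dist vertex y)"
      "\<And>y. r \<le> dist vertex y \<Longrightarrow> dist vertex y \<le> 2 * r \<Longrightarrow> BM_generator g y = -1"
    using outer_shell_function[OF r, of p] by blast
  \<comment> \<open>A continuous majorant of the indicator of the points beyond radius \<open>2 * r\<close> that vanishes on
    the sphere.\<close>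
  define h :: "'n star \<Rightarrow> real" where "h = (\<lambda>y. min 1 (\<bar>dist vertex y - r\<bar> / r))"
  \<comment> \<open>At least \<open>t / 2\<close> of the time is left after \<open>s n\<close>, and \<open>r\<^sup>2\<close> is the value of \<open>g\<close> at radius
    \<open>2 * r\<close>.\<close>
  define c where "c = min (t / 2) (r\<^sup>2)"
  have c: "0 < c" "c \<le> t / 2" "c \<le> r\<^sup>2" unfolding c_def using t r by auto
  define s where "s = (\<lambda>n. t / 2 * inverse (real (Suc n)))"
  have s: "0 < s n" "s n \<le> t / 2" for n
  proof -
    show "0 < s n" unfolding s_def using t by simp
    have "inverse (real (Suc n)) \<le> 1" by (simp add: field_simps)
    then have "t / 2 * inverse (real (Suc n)) \<le> t / 2 * 1" using t by (intro mult_left_mono) auto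
    then show "s n \<le> t / 2" unfolding s_def by simp
  qed
  have s_lim: "s \<longlonglongrightarrow> 0"
  proof -
    have "s \<longlonglongrightarrow> t / 2 * 0"
      unfolding s_def by (intro tendsto_intros LIMSEQ_inverse_real_of_nat)
    then show ?thesis by simp
  qed
  define V where "V = (\<lambda>n. {\<omega> \<in> space \<Omega>. \<forall>v\<in>{s n..t}. Z v \<omega> \<notin> ?S})"
  have V: "V n \<in> events" for n
    unfolding V_def using avoids_measurable[OF closed_radius(3)] s(1)[of n] sets_P
    by (auto simp: less_imp_le)
  have pre: "{\<omega> \<in> space \<Omega>. Z (s n) \<omega> \<in> A} \<in> events" if "A \<in> sets borel" for A n
    using measurable_sets[OF measurable_Z that, of "s n"] s(1)[of n] sets_P
    by (simp add: vimage_def Int_def conj_commute less_imp_le)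
  have h: "continuous_on UNIV h" "\<And>y. \<bar>h y\<bar> \<le> 1"
    unfolding h_def using r by (auto intro!: continuous_intros)
  have bound: "c * prob (\<Inter>n. V n) \<le> expectation (\<lambda>\<omega>. \<bar>f (Z (s n) \<omega>)\<bar>)
      + expectation (\<lambda>\<omega>. \<bar>g (Z (s n) \<omega>)\<bar>) + c * expectation (\<lambda>\<omega>. h (Z (s n) \<omega>))" for n
  proof -
    have st: "0 \<le> s n" "s n < t" "c \<le> t - s n" using s[of n] c t by auto
    let ?A = "{\<omega> \<in> space \<Omega>. Z (s n) \<omega> \<notin> ?Fi \<and> (\<forall>v\<in>{s n..t}. Z v \<omega> \<notin> ?S)}"
    let ?B = "{\<omega> \<in> space \<Omega>. Z (s n) \<omega> \<notin> ?Fo \<and> (\<forall>v\<in>{s n..t}. Z v \<omega> \<notin> ?S)}"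
    let ?C = "{\<omega> \<in> space \<Omega>. Z (s n) \<omega> \<in> {y. 2 * r \<le> dist vertex y}}"
    have A: "c * prob ?A \<le> expectation (\<lambda>\<omega>. \<bar>f (Z (s n) \<omega>)\<bar>)"
      by (rule avoidance_bound[OF generator f closed_radius(1) _ closed_radius(2)[of vertex r] _
            closed_radius(3) _ _ st]) (use fv in \<open>auto simp: power_mono\<close>)
    have B: "c * prob ?B \<le> expectation (\<lambda>\<omega>. \<bar>g (Z (s n) \<omega>)\<bar>)"
    proof (rule avoidance_bound[OF generator g closed_Fo _ closed_Ko _ closed_radius(3) _ _ st])
      show "c \<le> g y" if "y \<in> ?Ko" "y \<in> ?Fo" "y \<notin> ?S" for y
      proof -
        have "dist vertex y = 2 * r" using that by auto
        then show ?thesis using gv(1)[of y] c(3) r by (simp add: power2_eq_square)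
      qed
    qed (use gv r in auto)
    have C_ev: "?C \<in> events" by (rule pre) (simp add: closed_radius)
    have "prob ?C = expectation (indicator ?C)" using C_ev by simp
    also have "\<dots> \<le> expectation (\<lambda>\<omega>. h (Z (s n) \<omega>))"
    proof (rule integral_mono)
      show "integrable (P x) (\<lambda>\<omega>. h (Z (s n) \<omega>))"
        using h borel_measurable_continuous_on[OF h(1) measurable_Z[OF st(1)]]
        by (intro integrable_bounded[of _ 1])
      show "indicator ?C \<omega> \<le> h (Z (s n) \<omega>)" for \<omega>
        using r unfolding h_def by (auto simp: indicator_def field_simps)
      show "integrable (P x) (indicator ?C :: 'w \<Rightarrow> real)"
        by (rule integrable_real_indicator[OF C_ev]) (simp add: less_top[symmetric])
    qed
    finally have C: "prob ?C \<le> expectation (\<lambda>\<omega>. h (Z (s n) \<omega>))" .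
    have eq: "?A = {\<omega> \<in> space \<Omega>. Z (s n) \<omega> \<in> - ?Fi} \<inter> V n"
      "?B = {\<omega> \<in> space \<Omega>. Z (s n) \<omega> \<in> - ?Fo} \<inter> V n"
      unfolding V_def by auto
    have A_ev: "?A \<in> events" and B_ev: "?B \<in> events"
      unfolding eq
      by (intro sets.Int pre V borel_comp borel_closed closed_radius closed_Fo)+
    have "prob (\<Inter>n. V n) \<le> prob (?A \<union> ?B \<union> ?C)"
    proof (rule finite_measure_mono)
      show "(\<Inter>n. V n) \<subseteq> ?A \<union> ?B \<union> ?C"
      proof
        fix \<omega> assume "\<omega> \<in> (\<Inter>n. V n)"
        then have "\<omega> \<in> V n" by blast
        then have *: "\<omega> \<in> space \<Omega>" "\<forall>v\<in>{s n..t}. Z v \<omega> \<notin> ?S" unfolding V_def by auto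
        then have "Z (s n) \<omega> \<notin> ?S" using st by auto
        then show "\<omega> \<in> ?A \<union> ?B \<union> ?C" using * by auto
      qed
    qed (use A_ev B_ev C_ev in blast)
    also have "\<dots> \<le> prob (?A \<union> ?B) + prob ?C"
      using A_ev B_ev C_ev by (intro measure_Un_le sets.Un)
    also have "prob (?A \<union> ?B) \<le> prob ?A + prob ?B"
      using A_ev B_ev by (intro measure_Un_le)
    finally have "c * prob (\<Inter>n. V n) \<le> c * (prob ?A + prob ?B + prob ?C)"
      using c(1) by (intro mult_left_mono) auto
    also have "\<dots> = c * prob ?A + c * prob ?B + c * prob ?C" by (simp add: algebra_simps)
    also have "\<dots> \<le> expectation (\<lambda>\<omega>. \<bar>f (Z (s n) \<omega>)\<bar>)
      + expectation (\<lambda>\<omega>. \<bar>g (Z (s n) \<omega>)\<bar>) + c * expectation (\<lambda>\<omega>. h (Z (s n) \<omega>))"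
      using A B mult_left_mono[OF C less_imp_le[OF c(1)]] by simp
    finally show ?thesis .
  qed
  obtain Bf where Bf: "\<And>y. \<bar>f y\<bar> \<le> Bf" using C0_bounded[OF f(2)] by blast
  obtain Bg where Bg: "\<And>y. \<bar>g y\<bar> \<le> Bg" using C0_bounded[OF g(2)] by blast
  note lim = expectation_tendsto_start[OF _ _ less_imp_le[OF s(1)] s_lim, of _ _ x]
  have "(\<lambda>n. expectation (\<lambda>\<omega>. \<bar>f (Z (s n) \<omega>)\<bar>) + expectation (\<lambda>\<omega>. \<bar>g (Z (s n) \<omega>)\<bar>)
      + c * expectation (\<lambda>\<omega>. h (Z (s n) \<omega>))) \<longlonglongrightarrow> \<bar>f x\<bar> + \<bar>g x\<bar> + c * h x"
    using C0_continuous[OF f(2)] C0_continuous[OF g(2)] Bf Bg h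
    by (intro tendsto_add tendsto_mult tendsto_const lim[of "\<lambda>y. \<bar>f y\<bar>" Bf]
        lim[of "\<lambda>y. \<bar>g y\<bar>" Bg] lim[of h 1] continuous_on_rabs) auto
  moreover have "\<bar>f x\<bar> + \<bar>g x\<bar> + c * h x = 0"
    using fv(1)[of x] gv(1)[of x] x r unfolding h_def by simp
  ultimately have "c * prob (\<Inter>n. V n) \<le> 0"
    using bound by (metis (no_types, lifting) LIMSEQ_le_const)
  then have "prob (\<Inter>n. V n) = 0"
    using c(1) by (simp add: mult_le_0_iff measure_le_0_iff)
  then have "AE \<omega> in P x. \<omega> \<notin> (\<Inter>n. V n)"
    using V by (subst (asm) prob_eq_0) auto
  then show ?thesis
    using AE_space
  proof eventually_elim
    case (elim \<omega>)
    then obtain n where "\<omega> \<notin> V n" by blast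
    then obtain v where "v \<in> {s n..t}" "Z v \<omega> \<in> ?S"
      using elim unfolding V_def by (auto simp: space_P)
    then show ?case using s(1)[of n] by (intro exI[of _ v]) auto
  qed
qed

abbreviation (input) exits_at :: "'n \<Rightarrow> 'w set" where
  "exits_at e \<equiv> {\<omega> \<in> space \<Omega>.
    hitting_time Z {y. dist vertex y = r} \<omega> = hitting_time Z {ray e r} \<omega>}"

lemma exits_at_measurable: "exits_at e \<in> sets \<Omega>"
proof -
  have [measurable]: "hitting_time Z {y. dist vertex y = r} \<in> borel_measurable \<Omega>"
    "hitting_time Z {ray e r} \<in> borel_measurable \<Omega>"
    by (intro hitting_time_measurable closed_radius closed_singleton)+
  show ?thesis by measurable
qed

text \<open>The stopped value of \<open>f\<close> has expectation \<open>f y\<close> at every finite time horizon, and it is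
  eventually constant along almost every path, with limit the indicator of exiting at \<open>ray e r\<close>.\<close>

lemma exit_probability_inside:
  assumes p: "(\<Sum>k\<in>UNIV. p k) = 1" and x: "0 \<le> x" "x < r"
  shows "measure (P (ray j x)) (exits_at e) = ball_harmonic p r e j x"
proof -
  define y where "y = ray j x"
  have y: "dist vertex y < r" unfolding y_def using x by (simp add: dist_vertex_ray)
  interpret prob_space "P y" by (rule prob_space_P)
  let ?F = "{y :: 'n star. r \<le> dist vertex y}"
  obtain f where f: "f \<in> BM_domain p" "f \<in> C0" "BM_generator f \<in> C0"
    and fv: "\<And>j x. 0 \<le> x \<Longrightarrow> x \<le> r \<Longrightarrow> f (ray j x) = ball_harmonic p r e j x"
      "\<And>y. dist vertex y \<le> r \<Longrightarrow> BM_generator f y = 0"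
    using harmonic_function[OF r p, of e] by blast
  obtain B where B: "\<And>y. \<bar>f y\<bar> \<le> B" using C0_bounded[OF f(2)] by blast
  define \<Delta> where "\<Delta> = (\<lambda>n \<omega>. f (Z (first_hit Z ?F 0 (real (Suc n)) \<omega>) \<omega>) - f (Z 0 \<omega>)
      - 0 * (first_hit Z ?F 0 (real (Suc n)) \<omega> - 0))"
  have \<Delta>: "integrable (P y) (\<Delta> n)" "expectation (\<Delta> n) = 0" for n
    using Dynkin_first_hit[where \<gamma> = 0 and s = 0 and t = "real (Suc n)" and x = y,
        OF generator f closed_radius(1)[where v = vertex and r = r]] fv(2)
    unfolding \<Delta>_def by auto
  have W: "exits_at e \<in> events" using exits_at_measurable sets_P by simp
  have "(\<lambda>n. expectation (\<Delta> n)) \<longlonglongrightarrow> expectation (\<lambda>\<omega>. indicator (exits_at e) \<omega> - f y)"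
  proof (rule integral_dominated_convergence[where w = "\<lambda>_. 2 * B"])
    show "AE \<omega> in P y. (\<lambda>n. \<Delta> n \<omega>) \<longlonglongrightarrow> indicator (exits_at e) \<omega> - f y"
      using reaches_sphere[OF y] start[of y] AE_space
    proof eventually_elim
      case (elim \<omega>)
      then obtain v where v: "0 \<le> v" "dist vertex (Z v \<omega>) = r" by blast
      have \<omega>: "\<omega> \<in> space \<Omega>" using elim by (simp add: space_P)
      have "\<Delta> n \<omega> = indicator (exits_at e) \<omega> - f y" if n: "nat \<lceil>v\<rceil> \<le> n" for n
      proof -
        define \<tau> where "\<tau> = first_hit Z ?F 0 (real (Suc n)) \<omega>"
        have "v \<le> real (Suc n)" using n by linarith
        then have \<tau>: "dist vertex (Z \<tau> \<omega>) = r" "\<omega> \<in> exits_at e \<longleftrightarrow> Z \<tau> \<omega> = ray e r"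
          using exit_point(1)[of Z \<omega> r v "real (Suc n)", OF continuous_paths[OF \<omega>] r _ v(1) _ v(2)]
            exit_point(2)[of Z \<omega> r v "real (Suc n)" e, OF continuous_paths[OF \<omega>] r _ v(1) _ v(2)]
            elim y \<omega> unfolding \<tau>_def by auto
        obtain k where k: "Z \<tau> \<omega> = ray k r" by (rule sphere_cases[OF \<tau>(1)])
        then have "f (Z \<tau> \<omega>) = indicator (exits_at e) \<omega>"
          using fv(1)[of r k] r \<tau>(2) ray_eq_iff[OF r, of k e]
          by (simp add: ball_harmonic_def indicator_def)
        then show ?thesis unfolding \<Delta>_def \<tau>_def[symmetric] using elim by simp
      qed
      then show ?case by (intro tendsto_eventually eventually_sequentiallyI[of "nat \<lceil>v\<rceil>"])
    qed
    show "AE \<omega> in P y. norm (\<Delta> n \<omega>) \<le> 2 * B" for n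
    proof (intro AE_I2)
      fix \<omega>
      show "norm (\<Delta> n \<omega>) \<le> 2 * B"
        using B[of "Z (first_hit Z ?F 0 (real (Suc n)) \<omega>) \<omega>"] B[of "Z 0 \<omega>"]
        unfolding \<Delta>_def by simp
    qed
  qed (use \<Delta>(1) W in auto)
  then have "expectation (\<lambda>\<omega>. indicator (exits_at e) \<omega> - f y) = 0"
    using \<Delta>(2) LIMSEQ_unique[OF _ tendsto_const] by simp
  moreover have "expectation (\<lambda>\<omega>. indicator (exits_at e) \<omega> - f y) = prob (exits_at e) - f y"
    using W
    by (subst Bochner_Integration.integral_diff)
      (auto simp: prob_space less_top[symmetric] intro!: integrable_real_indicator simp del: mem_Collect_eq)
  ultimately show ?thesis using fv(1)[of x j] x unfolding y_def by simp
qed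

text \<open>By regularity the sphere is hit at time \<open>0\<close>.  Different points of the sphere are \<open>2 * r\<close> apart,
  so that these early visits are visits to the starting point.\<close>

lemma exit_probability_sphere: "measure (P (ray j r)) (exits_at e) = of_bool (j = e)"
proof -
  define y where "y = ray j r"
  have y: "dist vertex y = r" unfolding y_def using r by (simp add: dist_vertex_ray)
  interpret prob_space "P y" by (rule prob_space_P)
  have W: "exits_at e \<in> events" using exits_at_measurable sets_P by simp
  have "AE \<omega> in P y. \<forall>n. \<exists>v. 0 < v \<and> v \<le> inverse (real (Suc n)) \<and> dist vertex (Z v \<omega>) = r"
    unfolding AE_all_countable by (intro allI sphere_regular y) simp
  then have AE: "AE \<omega> in P y. \<omega> \<in> exits_at e \<longleftrightarrow> j = e"
    using start[of y] AE_space
  proof eventually_elim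
    case (elim \<omega>)
    have \<omega>: "\<omega> \<in> space \<Omega>" using elim by (simp add: space_P)
    have soon: "\<exists>v. 0 < v \<and> v < \<delta> \<and> dist vertex (Z v \<omega>) = r" if "0 < \<delta>" for \<delta>
      using elim(1) reals_Archimedean[OF that] by (meson le_less_trans)
    have "continuous_on {0..} (\<lambda>t. Z t \<omega>)" by (rule continuous_paths[OF \<omega>])
    then have "\<exists>\<delta>>0. \<forall>v\<in>{0..}. dist v 0 < \<delta> \<longrightarrow> dist (Z v \<omega>) (Z 0 \<omega>) < r"
      unfolding continuous_on_iff using r by force
    then obtain \<delta> where \<delta>: "0 < \<delta>"
      "\<And>v. 0 \<le> v \<Longrightarrow> v < \<delta> \<Longrightarrow> dist (Z v \<omega>) (ray j r) < r"
      using elim(2) unfolding y_def by (auto simp: dist_real_def)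
    have stay: "Z v \<omega> = ray j r" if v: "0 \<le> v" "v < \<delta>" "dist vertex (Z v \<omega>) = r" for v
    proof -
      obtain k where k: "Z v \<omega> = ray k r" by (rule sphere_cases[OF v(3)])
      then have "k = j" using \<delta>(2)[OF v(1,2)] dist_sphere[OF r, of k j] r
        by (auto split: if_splits)
      then show ?thesis using k by simp
    qed
    have zero: "hitting_time Z {y. dist vertex y = r} \<omega> = 0" "hitting_time Z {ray j r} \<omega> = 0"
    proof -
      have small: "\<exists>v>0. Z v \<omega> = ray j r \<and> dist vertex (Z v \<omega>) = r \<and> ennreal v < z"
        if "0 < z" for z :: ennreal
      proof -
        obtain a where a: "0 < a" "ennreal a < z"
        proof -
          obtain w where w: "0 < w" "w < z" using dense[OF \<open>0 < z\<close>] by blast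
          moreover obtain a where "w = ennreal a" "0 \<le> a" using w(2) by (cases w) auto
          ultimately show thesis using that[of a] by simp
        qed
        obtain v where v: "0 < v" "v < min a \<delta>" "dist vertex (Z v \<omega>) = r"
          using soon[of "min a \<delta>"] a \<delta>(1) by auto
        have "ennreal v < z" using ennreal_leI[of v a] v(2) a(2) by auto
        then show ?thesis using stay[of v] v by (intro exI[of _ v]) auto
      qed
      have "\<not> 0 < hitting_time Z {y. dist vertex y = r} \<omega>"
      proof
        assume "0 < hitting_time Z {y. dist vertex y = r} \<omega>"
        from small[OF this] show False
          using hitting_time_less_iff[of Z "{y. dist vertex y = r}" \<omega>] by blast
      qed
      then show "hitting_time Z {y. dist vertex y = r} \<omega> = 0" by simp
      have "\<not> 0 < hitting_time Z {ray j r} \<omega>"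
      proof
        assume "0 < hitting_time Z {ray j r} \<omega>"
        from small[OF this] show False
          using hitting_time_less_iff[of Z "{ray j r}" \<omega>] by blast
      qed
      then show "hitting_time Z {ray j r} \<omega> = 0" by simp
    qed
    have "hitting_time Z {ray e r} \<omega> \<noteq> 0" if "j \<noteq> e"
    proof
      assume "hitting_time Z {ray e r} \<omega> = 0"
      then have "hitting_time Z {ray e r} \<omega> < ennreal \<delta>" using \<delta>(1) by simp
      then obtain v where v: "0 < v" "Z v \<omega> = ray e r" "ennreal v < ennreal \<delta>"
        unfolding hitting_time_less_iff by auto
      then have "v < \<delta>" by (simp add: ennreal_less_iff)
      then have "ray e r = ray j r" using stay[of v] v r by (simp add: dist_vertex_ray)
      then show False using ray_eq_iff[OF r, of e j] that by simp
    qed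
    then show ?case using zero \<omega> by (cases "j = e") auto
  qed
  have "prob (exits_at e) = of_bool (j = e)"
  proof (cases "j = e")
    case True
    then show ?thesis using AE W by (simp add: prob_eq_1)
  next
    case False
    then show ?thesis using AE W by (simp add: prob_eq_0)
  qed
  then show ?thesis unfolding y_def .
qed

end

theorem theorem13:
  fixes p :: "'n::finite \<Rightarrow> real" and b c r :: real and e :: 'n
    and \<Omega> :: "'w measure" and P :: "'n star \<Rightarrow> 'w measure" and Z :: "real \<Rightarrow> 'w \<Rightarrow> 'n star"
    and u :: "'n star \<Rightarrow> real"
  assumes "\<And>k. 0 \<le> p k \<and> p k \<le> 1" and "(\<Sum>k\<in>UNIV. p k) = 1"
    and "0 < b" and "0 < c" and "b + c = 1"
    and "star_BM p \<Omega> P Z"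
    and "0 < r"
    and "\<And>x. u x = measure (P x) {\<omega> \<in> space (P x).
           hitting_time Z {y. dist vertex y = r} \<omega> = hitting_time Z {ray e r} \<omega>}"
  shows "u \<in> sticky_dom_ball p b c r \<and>
    (\<forall>x\<in>ball vertex r. sticky_op u x = 0) \<and>
    u (ray e r) = 1 \<and>
    (\<forall>j. j \<noteq> e \<longrightarrow> u (ray j r) = 0)"
proof -
  note p = assms(2) and BM = assms(6) and r = assms(7)
  interpret continuous_strong_Markov_process \<Omega> P Z
    using BM unfolding star_BM_def by blast
  let ?g = "ball_harmonic p r e" and ?g' = "\<lambda>j. (of_bool (j = e) - p e) / r"
  have sphere: "u (ray j r) = of_bool (j = e)" for j
    using exit_probability_sphere[OF BM r, of j e] by (simp add: assms(8) space_P)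
  have u: "u (ray j x) = ?g j x" if "0 \<le> x" "x \<le> r" for j x
  proof (cases "x = r")
    case True
    then show ?thesis using sphere r by (simp add: ball_harmonic_def)
  next
    case False
    then show ?thesis
      using exit_probability_inside[OF BM r p that(1), of j e] that(2)
      by (simp add: assms(8) space_P)
  qed
  obtain f where f: "f \<in> C0" "\<And>j x. 0 \<le> x \<Longrightarrow> x \<le> r \<Longrightarrow> f (ray j x) = ?g j x"
    using harmonic_function[OF r p, of e] by blast
  have "u y = f y" if "y \<in> cball vertex r" for y
  proof -
    obtain j x where "0 \<le> x" "y = ray j x" by (rule ray_cases[of y])
    then show ?thesis using that f(2) u by (simp add: dist_vertex_ray)
  qed
  then have cont: "continuous_on (cball vertex r) u"
    using continuous_on_subset[OF C0_continuous[OF f(1)] subset_UNIV, of "cball vertex r"]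
      continuous_on_cong[of "cball vertex r" "cball vertex r" u f] by blast
  have u': "\<And>j x. 0 < x \<Longrightarrow> x < r \<Longrightarrow> u (ray j x) = ?g j x" using u by simp
  have d1v: "d1_vertex u j = ?g' j" for j
    by (rule d1_vertex_eq[of r u ?g "\<lambda>j _. ?g' j" "\<lambda>_ _. 0" 0])
      (rule r ball_harmonic_DERIV DERIV_const refl continuous_const | erule (1) u')+
  have d2v: "d2_vertex u = 0"
    by (rule d2_vertex_eq[of r u ?g "\<lambda>j _. ?g' j" "\<lambda>_ _. 0" 0])
      (rule r ball_harmonic_DERIV DERIV_const refl continuous_const | erule (1) u')+
  have d2l: "(d2 u j \<longlongrightarrow> 0) (at_right 0)" for j
    by (rule d2_tendsto[of r u ?g "\<lambda>j _. ?g' j" "\<lambda>_ _. 0" 0])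
      (rule r ball_harmonic_DERIV DERIV_const refl continuous_const | erule (1) u')+
  have d2: "d2 u j x = 0" if "0 < x" "x < r" for j x
    by (rule d1_d2_eq(4)[OF open_greaterThanLessThan[of 0 r] _ ball_harmonic_DERIV DERIV_const])
      (use that u' in auto)
  have C2: "C2_on_rays {0<..<r} u"
    by (rule C2_on_raysI[OF _ _ ball_harmonic_DERIV DERIV_const continuous_on_const])
      (use u' in auto)
  have "sticky_vertex_condition p b c u"
    unfolding sticky_vertex_condition_def d2v d1v using ball_harmonic_balance[OF p, of e r] by simp
  then have "u \<in> sticky_dom_ball p b c r"
    unfolding sticky_dom_ball_def using cont C2 d2l by blast
  moreover have "sticky_op u y = 0" if "y \<in> ball vertex r" for y
  proof -
    obtain j x where jx: "0 \<le> x" "y = ray j x" by (rule ray_cases[of y])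
    then show ?thesis
      using that d2[of x j] d2v unfolding sticky_op_def second_deriv_def
      by (cases "x = 0") (auto simp: ray_0 glue_vertex glue_ray dist_vertex_ray)
  qed
  ultimately show ?thesis using sphere by simp
qed

end
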